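(* Let $\Gamma=(G,\sigma)$ be a signed graph with $G=(V,E)$, $|V|=n$. Let $\mathcal G$ be the set of all subgraphs of $\Gamma$ and $|V_{\Gamma_0}|$ the number of vertices of $\Gamma_0\in\mathcal G$, and let $\mathcal C:=\max_{1\le i\le n}|\kappa_i/\mu_i|$. For every $p\ge1$ and $1\le k\le n$, $$\lambda_k^{(p)}\ \ge\ 2^{p-1}\max_{\substack{\Gamma_0\in\mathcal G\\ |V_{\Gamma_0}|\ge n-k+1}}\lambda_{|V_{\Gamma_0}|-n+k}(A^\mu_{-\Gamma_0})-\mathcal C\ =\ 2^{p-1}\max_{\substack{\Gamma_0\in\mathcal G\\ |V_{\Gamma_0}|=n}}\lambda_k(A^\mu_{-\Gamma_0})-\mathcal C.$$
   Context: $G=(V,E)$ is a finite undirected graph without self-loops, $V=\{1,\dots,n\}$. A signed graph $\Gamma=(G,\sigma)$ has signature $\sigma:E\to\{\pm1\}$, $\sigma_{ij}=\sigma(\{i,j\})$, edge weight $w:E\to(0,\infty)$, vertex measure $\mu:V\to(0,\infty)$, potential $\kappa:V\to\mathbb R$. A subgraph $\Gamma_0$ has vertex set $V_0\subset V$ and edge set $E_0\subset E$ of edges with both ends in $V_0$, with restricted $\sigma,w,\mu,\kappa$. $-\Gamma_0$ is $\Gamma_0$ with signature negated. $A_{\Gamma}$ has entries $\sigma_{ij}w_{ij}$ for $i\sim j$, $0$ otherwise; $A^\mu_\Gamma=\mathrm{diag}(\mu)^{-1}A_\Gamma$; eigenvalues ordered $\lambda_1\le\lambda_2\le\cdots$.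 For $p\ge1$ and nonzero $f$, $\mathcal R_p^\sigma(f)=\frac{\sum_{\{i,j\}\in E}w_{ij}|f(i)-\sigma_{ij}f(j)|^p+\sum_i\kappa_i|f(i)|^p}{\sum_i\mu_i|f(i)|^p}$; $\mathcal S_p=\{f:\sum_i\mu_i|f(i)|^p=1\}$; Krasnoselskii genus $\gamma(B)$ of closed symmetric $B\subset\mathbb R^n\setminus\{0\}$: least $k$ with an odd continuous map $B\to\mathbb R^k\setminus\{0\}$; $\mathcal F_k(\mathcal S_p)$ = closed symmetric $B\subset\mathcal S_p$ with $\gamma(B)\ge k$; $\lambda_k^{(p)}=\min_{B\in\mathcal F_k(\mathcal S_p)}\max_{f\in B}\mathcal R_p^\sigma(f)$. *)

theory Defs
  imports "HOL-Analysis.Analysis" "Jordan_Normal_Form.Char_Poly"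
begin

definition signed_graph ::
  "nat \<Rightarrow> nat set set \<Rightarrow> (nat set \<Rightarrow> real) \<Rightarrow> (nat set \<Rightarrow> real) \<Rightarrow> (nat \<Rightarrow> real) \<Rightarrow> bool" where
  "signed_graph n E sg w mu \<longleftrightarrow>
     (\<forall>e\<in>E. \<exists>i j. e = {i, j} \<and> i \<noteq> j \<and> i \<in> {1..n} \<and> j \<in> {1..n}) \<and>
     (\<forall>e\<in>E. sg e = 1 \<or> sg e = -1) \<and>
     (\<forall>e\<in>E. w e > 0) \<and>
     (\<forall>i\<in>{1..n}. mu i > 0)"

(* Subgraph (V0,E0): V0 \<subseteq> V, E0 \<subseteq> E, every edge of E0 has both ends in V0;
   signature, weights, measure, potential are the restrictions (same functions). *)
definition is_subgraph :: "nat \<Rightarrow> nat set set \<Rightarrow> nat set \<Rightarrow> nat set set \<Rightarrow> bool" where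
  "is_subgraph n E V0 E0 \<longleftrightarrow> V0 \<subseteq> {1..n} \<and> E0 \<subseteq> E \<and> (\<forall>e\<in>E0. e \<subseteq> V0)"

(* A^mu_Gamma0 = diag(mu)^{-1} A_Gamma0 for the subgraph (V0,E0) with signature s,
   rows/columns indexed by the elements of V0 in increasing order. *)
definition mu_adj_matrix ::
  "nat set \<Rightarrow> nat set set \<Rightarrow> (nat set \<Rightarrow> real) \<Rightarrow> (nat set \<Rightarrow> real) \<Rightarrow> (nat \<Rightarrow> real) \<Rightarrow> real mat" where
  "mu_adj_matrix V0 E0 s w mu =
     (let vs = sorted_list_of_set V0
      in mat (card V0) (card V0)
           (\<lambda>(a, b). (1 / mu (vs ! a)) *
              (if {vs ! a, vs ! b} \<in> E0 then s {vs ! a, vs ! b} * w {vs ! a, vs ! b} else 0)))"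

definition eigval :: "real mat \<Rightarrow> nat \<Rightarrow> real" where
  "eigval M k = sorted_list_of_multiset (proots (char_poly M)) ! (k - 1)"

definition vfuns :: "nat \<Rightarrow> (nat \<Rightarrow> real) set" where
  "vfuns n = {f. \<forall>i. i \<notin> {1..n} \<longrightarrow> f i = 0}"

definition rayleigh_p ::
  "nat \<Rightarrow> nat set set \<Rightarrow> (nat set \<Rightarrow> real) \<Rightarrow> (nat set \<Rightarrow> real) \<Rightarrow> (nat \<Rightarrow> real) \<Rightarrow> (nat \<Rightarrow> real)
   \<Rightarrow> real \<Rightarrow> (nat \<Rightarrow> real) \<Rightarrow> real" where
  "rayleigh_p n E sg w mu kappa p f =
     ((\<Sum>i=1..n. \<Sum>j=1..n. if i < j \<and> {i, j} \<in> E
                             then w {i, j} * \<bar>f i - sg {i, j} * f j\<bar> powr p else 0)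
      + (\<Sum>i=1..n. kappa i * \<bar>f i\<bar> powr p))
     / (\<Sum>i=1..n. mu i * \<bar>f i\<bar> powr p)"

definition sphere_p :: "nat \<Rightarrow> (nat \<Rightarrow> real) \<Rightarrow> real \<Rightarrow> (nat \<Rightarrow> real) set" where
  "sphere_p n mu p = {f \<in> vfuns n. (\<Sum>i=1..n. mu i * \<bar>f i\<bar> powr p) = 1}"

(* existence of an odd continuous map B \<rightarrow> R^k \ {0};  R^k is represented as the
   functions nat \<Rightarrow> real vanishing at all indices \<ge> k (product topology) *)
definition odd_map_to_sphere :: "(nat \<Rightarrow> real) set \<Rightarrow> nat \<Rightarrow> bool" where
  "odd_map_to_sphere B k \<longleftrightarrow>
     (\<exists>g :: (nat \<Rightarrow> real) \<Rightarrow> (nat \<Rightarrow> real).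
        continuous_on B g \<and>
        (\<forall>x\<in>B. g (\<lambda>i. - x i) = (\<lambda>i. - g x i)) \<and>
        (\<forall>x\<in>B. (\<forall>i\<ge>k. g x i = 0) \<and> (\<exists>i<k. g x i \<noteq> 0)))"

definition kgenus :: "(nat \<Rightarrow> real) set \<Rightarrow> nat" where
  "kgenus B = (LEAST k. odd_map_to_sphere B k)"

definition Fk :: "nat \<Rightarrow> (nat \<Rightarrow> real) \<Rightarrow> real \<Rightarrow> nat \<Rightarrow> (nat \<Rightarrow> real) set set" where
  "Fk n mu p k = {B. B \<subseteq> sphere_p n mu p \<and> closed B \<and> (\<forall>x\<in>B. (\<lambda>i. - x i) \<in> B)
                     \<and> kgenus B \<ge> k}"

definition lambda_p ::
  "nat \<Rightarrow> nat set set \<Rightarrow> (nat set \<Rightarrow> real) \<Rightarrow> (nat set \<Rightarrow> real) \<Rightarrow> (nat \<Rightarrow> real) \<Rightarrow> (nat \<Rightarrow> real)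
   \<Rightarrow> real \<Rightarrow> nat \<Rightarrow> real" where
  "lambda_p n E sg w mu kappa p k =
     (INF B\<in>Fk n mu p k. SUP f\<in>B. rayleigh_p n E sg w mu kappa p f)"

end

theory Submission
  imports Defs "HOL-Homology.Homology" "HOL-Library.Z2"
begin

text \<open>
  By AM-GM, \<open>|x - \<sigma> y|^p \<ge> - 2^p \<sigma> g h\<close> where \<open>g\<close>, \<open>h\<close> are the signed \<open>p/2\<close>-th powers of \<open>x\<close>, \<open>y\<close>. Hence the
  \<open>p\<close>-Rayleigh quotient at \<open>f\<close> dominates \<open>2^(p-1)\<close> times the quadratic form of the negated adjacency
  matrix of any spanning subgraph at the signed power of \<open>f\<close>, up to the potential. A symmetric set of genus
  at least \<open>k\<close> contains a function whose signed power is orthogonal to the first \<open>k - 1\<close> eigenvectors,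
  as these conditions form an odd continuous map to \<open>R^(k-1)\<close>; there the form is at least the \<open>k\<close>-th
  eigenvalue. A general subgraph is compared with the spanning one having the same edges by interlacing.

  The infimum defining the variational eigenvalue is meaningful only if some admissible set exists, which is
  the Borsuk-Ulam theorem. It is proved by a mod 2 cup product: let \<open>c 0, \<dots>, c n\<close> be singular chains
  on the \<open>n\<close>-sphere with boundary of \<open>c (k + 1)\<close> equal to \<open>c k\<close> plus or minus its antipode. If \<open>h i\<close> is the
  sign (in the field with two elements) of the \<open>i\<close>-th component of an odd map, then the cup product
  of the coboundaries of \<open>h 0, \<dots>, h (k - 1)\<close> takes the value 1 on \<open>c k\<close>, by induction on \<open>k\<close>. If the
  map had no zero, a fine subdivision would place every simplex in a region where some component
  has constant sign, so the value for \<open>k = n\<close> would be 0.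
\<close>

section \<open>The Borsuk-Ulam theorem\<close>

declare add_bit_eq_xor [simp del] mult_bit_eq_and [simp del]

lemma bit_add_self: "(x::bit) + x = 0"
  by (cases x) auto

text \<open>\<open>v \<circ> omit j\<close> is the face of the ordered simplex \<open>v\<close>
  opposite to vertex \<open>j\<close>.\<close>

definition omit :: "nat \<Rightarrow> nat \<Rightarrow> nat"
  where "omit j i = (if i < j then i else Suc i)"

text \<open>
  The mod 2 cup product of the coboundaries of the 0-cochains \<open>h (k - 1), \<dots>, h 0\<close>, evaluated on the
  ordered simplex \<open>v 0, \<dots>, v k\<close>.
\<close>

primrec sign_cup :: "(nat \<Rightarrow> 'a \<Rightarrow> bit) \<Rightarrow> nat \<Rightarrow> (nat \<Rightarrow> 'a) \<Rightarrow> bit"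
  where
    "sign_cup h 0 v = 1"
  | "sign_cup h (Suc k) v = (h k (v 0) + h k (v 1)) * sign_cup h k (v \<circ> Suc)"

lemma omit_0: "v \<circ> omit 0 = v \<circ> Suc"
  by (auto simp: omit_def fun_eq_iff)

lemma omit_Suc: "(v \<circ> omit (Suc j)) \<circ> Suc = (v \<circ> Suc) \<circ> omit j"
  by (auto simp: omit_def fun_eq_iff)

text \<open>Only faces 0 and 1 change the leading edge. By the induction hypothesis the remaining
  faces add up to \<open>W\<close> times the value of that edge, and the three sides of the triangle
  \<open>v 0, v 1, v 2\<close> sum to zero mod 2.\<close>

lemma sign_cup_cocycle: "(\<Sum>j\<le>Suc k. sign_cup h k (v \<circ> omit j)) = 0"
proof (induction k arbitrary: v)
  case 0
  then show ?case by (simp add: bit_add_self)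
next
  case (Suc k)
  define w where "w = v \<circ> Suc"
  define R where "R = (\<Sum>j\<le>k. sign_cup h k (w \<circ> omit (Suc j)))"
  define W where "W = sign_cup h k (w \<circ> Suc)"
  have "W + R = 0"
    using Suc.IH[of w] by (simp only: sum.atMost_Suc_shift omit_0 R_def W_def)
  then have R: "R = W" by (cases W; cases R) auto
  have *: "sign_cup h (Suc k) (v \<circ> omit (Suc (Suc j))) = (h k (v 0) + h k (v 1)) * sign_cup h k (w \<circ> omit (Suc j))" for j
    by (simp only: sign_cup.simps omit_Suc w_def) (simp add: omit_def)
  have "(\<Sum>j\<le>Suc (Suc k). sign_cup h (Suc k) (v \<circ> omit j)) =
      sign_cup h (Suc k) (v \<circ> omit 0) + (sign_cup h (Suc k) (v \<circ> omit (Suc 0)) 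
        + (\<Sum>j\<le>k. sign_cup h (Suc k) (v \<circ> omit (Suc (Suc j)))))"
    by (simp only: sum.atMost_Suc_shift)
  also have "\<dots> = (h k (v 1) + h k (v 2)) * W + ((h k (v 0) + h k (v 2)) * W + (h k (v 0) + h k (v 1)) * R)"
    unfolding * sum_distrib_left[symmetric] R_def[symmetric]
    unfolding sign_cup.simps omit_Suc omit_0 by (simp add: omit_def w_def W_def numeral_2_eq_2)
  also have "\<dots> = 0"
    unfolding R by (cases "h k (v 0)"; cases "h k (v 1)"; cases "h k (v 2)"; cases W) auto
  finally show ?case .
qed

text \<open>Face 0 starts at \<open>v 1\<close>, all others start at \<open>v 0\<close>. By the
  cocycle identity both groups have the same sum, so the leading factors combine to the value of the
  edge from \<open>v 0\<close> to \<open>v 1\<close>.\<close>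

lemma sign_cup_coboundary:
  "(\<Sum>j\<le>Suc k. h k ((v \<circ> omit j) 0) * sign_cup h k (v \<circ> omit j)) = sign_cup h (Suc k) v"
proof -
  define R where "R = (\<Sum>j\<le>k. sign_cup h k (v \<circ> omit (Suc j)))"
  define W where "W = sign_cup h k (v \<circ> Suc)"
  have "W + R = 0"
    using sign_cup_cocycle[of h k v] by (simp only: sum.atMost_Suc_shift omit_0 R_def W_def)
  then have R: "R = W" by (cases W; cases R) auto
  have "(\<Sum>j\<le>Suc k. h k ((v \<circ> omit j) 0) * sign_cup h k (v \<circ> omit j)) = h k (v 1) * W + h k (v 0) * R"
    unfolding sum.atMost_Suc_shift omit_0 R_def W_def sum_distrib_left by (simp add: omit_def)
  then show ?thesis by (simp add: R W_def algebra_simps)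
qed

section \<open>Pairing of mod 2 cochains with integral singular chains\<close>

definition cochain_eval :: "('b \<Rightarrow> bit) \<Rightarrow> ('b \<Rightarrow>\<^sub>0 int) \<Rightarrow> bit"
  where "cochain_eval \<phi> c = (\<Sum>s\<in>Poly_Mapping.keys c. of_int (Poly_Mapping.lookup c s) * \<phi> s)"

lemma cochain_eval_superset:
  assumes "finite A" "Poly_Mapping.keys c \<subseteq> A"
  shows "cochain_eval \<phi> c = (\<Sum>s\<in>A. of_int (Poly_Mapping.lookup c s) * \<phi> s)"
  unfolding cochain_eval_def using assms
  by (intro sum.mono_neutral_left) (auto simp: in_keys_iff)

lemma cochain_eval_0 [simp]: "cochain_eval \<phi> 0 = 0"
  by (simp add: cochain_eval_def)

lemma cochain_eval_of [simp]: "cochain_eval \<phi> (frag_of s) = \<phi> s"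
  by (simp add: cochain_eval_def)

lemma cochain_eval_add: "cochain_eval \<phi> (c + d) = cochain_eval \<phi> c + cochain_eval \<phi> d"
proof -
  let ?A = "Poly_Mapping.keys c \<union> Poly_Mapping.keys d"
  show ?thesis
    using keys_add[of c d]
    by (simp add: cochain_eval_superset[of ?A] lookup_add algebra_simps sum.distrib)
qed

lemma cochain_eval_cmul: "cochain_eval \<phi> (frag_cmul a c) = of_int a * cochain_eval \<phi> c"
  using keys_cmul[of a c]
  by (simp add: cochain_eval_superset[of "Poly_Mapping.keys c"] sum_distrib_left mult.assoc)

lemma cochain_eval_diff: "cochain_eval \<phi> (c - d) = cochain_eval \<phi> c - cochain_eval \<phi> d"
  using cochain_eval_add[of \<phi> "c - d" d] by simp

lemma cochain_eval_sum: "cochain_eval \<phi> (\<Sum>i\<in>I. c i) = (\<Sum>i\<in>I. cochain_eval \<phi> (c i))"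
  by (induction I rule: infinite_finite_induct) (auto simp: cochain_eval_add)

text \<open>Chains keep integer coefficients until \<open>cochain_eval\<close> reduces them mod 2,
  so the signs in boundaries and antipodal sums have no effect.\<close>

lemma bit_of_int_sign: "(of_int ((-1) ^ k) :: bit) = 1"
  by (induction k) auto

definition simplex_vertices :: "((nat \<Rightarrow> real) \<Rightarrow> 'a) \<Rightarrow> nat \<Rightarrow> 'a"
  where "simplex_vertices s i = s (\<lambda>j. if j = i then 1 else 0)"

lemma simplical_face_vertex:
  "simplical_face j (\<lambda>l. if l = i then 1 else (0::real)) = (\<lambda>l. if l = omit j i then 1 else 0)"
  by (auto simp: simplical_face_def omit_def fun_eq_iff)

lemma vertices_singular_face:
  assumes "i \<le> k"
  shows "simplex_vertices (singular_face (Suc k) j s) i = simplex_vertices s (omit j i)"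
  using assms by (simp add: simplex_vertices_def singular_face_def simplical_face_vertex)

lemma vertices_simplex_map:
  assumes "i \<le> k"
  shows "simplex_vertices (simplex_map k a s) i = a (simplex_vertices s i)"
  using assms by (simp add: simplex_vertices_def simplex_map_def)

lemma sign_cup_cong: "(\<And>i. i \<le> k \<Longrightarrow> v i = w i) \<Longrightarrow> sign_cup h k v = sign_cup h k w"
proof (induction k arbitrary: v w)
  case (Suc k)
  have "sign_cup h k (v \<circ> Suc) = sign_cup h k (w \<circ> Suc)"
    by (rule Suc.IH) (simp add: Suc.prems)
  moreover have "v 0 = w 0" "v 1 = w 1" by (simp_all add: Suc.prems)
  ultimately show ?case by (simp only: sign_cup.simps)
qed simp

text \<open>Stokes' formula. By linearity a single simplex suffices; its faces have the vertices
  selected by \<open>omit\<close>, so \<open>sign_cup_coboundary\<close> applies.\<close>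

lemma cochain_eval_boundary:
  "cochain_eval (\<lambda>s. h k (simplex_vertices s 0) * sign_cup h k (simplex_vertices s)) (chain_boundary (Suc k) c)
    = cochain_eval (\<lambda>s. sign_cup h (Suc k) (simplex_vertices s)) c" (is "?l c = ?r c")
  using subset_UNIV
proof (induction c rule: frag_induction)
  case (one s)
  have "?l (frag_of s) = (\<Sum>j\<le>Suc k. h k (simplex_vertices (singular_face (Suc k) j s) 0) 
      * sign_cup h k (simplex_vertices (singular_face (Suc k) j s)))"
    by (simp only: chain_boundary_of cochain_eval_sum cochain_eval_cmul bit_of_int_sign cochain_eval_of nat.distinct if_False mult_1_left)
  also have "\<dots> = (\<Sum>j\<le>Suc k. h k ((simplex_vertices s \<circ> omit j) 0) * sign_cup h k (simplex_vertices s \<circ> omit j))"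
  proof (rule sum.cong[OF refl])
    fix j
    have "sign_cup h k (simplex_vertices (singular_face (Suc k) j s)) = sign_cup h k (simplex_vertices s \<circ> omit j)"
      by (rule sign_cup_cong) (simp add: vertices_singular_face)
    then show "h k (simplex_vertices (singular_face (Suc k) j s) 0) 
        * sign_cup h k (simplex_vertices (singular_face (Suc k) j s)) 
      = h k ((simplex_vertices s \<circ> omit j) 0) * sign_cup h k (simplex_vertices s \<circ> omit j)"
      by (simp add: vertices_singular_face)
  qed
  also have "\<dots> = sign_cup h (Suc k) (simplex_vertices s)"
    by (rule sign_cup_coboundary)
  finally show ?case by (simp only: cochain_eval_of)
qed (auto simp only: chain_boundary_diff cochain_eval_diff cochain_eval_0 chain_boundary_0)

text \<open>Each factor compares two consecutive vertices, and both of its terms change by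
  1.\<close>

lemma sign_cup_antipodal:
  assumes "\<And>j i. j < k \<Longrightarrow> i \<le> k \<Longrightarrow> h j (a (v i)) = h j (v i) + 1"
  shows "sign_cup h k (\<lambda>i. a (v i)) = sign_cup h k v"
  using assms
proof (induction k arbitrary: v)
  case (Suc k)
  have "sign_cup h k ((\<lambda>i. a (v i)) \<circ> Suc) = sign_cup h k (v \<circ> Suc)"
    using Suc.IH[of "v \<circ> Suc"] Suc.prems by (simp add: o_def)
  moreover have "h k (a (v 0)) + h k (a (v 1)) = h k (v 0) + h k (v 1)"
    using Suc.prems[of k 0] Suc.prems[of k 1] by (cases "h k (v 0)"; cases "h k (v 1)") auto
  ultimately show ?case by simp
qed auto

lemma vertex_in_topspace:
  assumes "singular_simplex p X s" "i \<le> p"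
  shows "simplex_vertices s i \<in> topspace X"
  using assms by (auto simp: singular_simplex_def simplex_vertices_def continuous_map_def)

text \<open>
  If every \<open>h j\<close> changes value under \<open>a\<close>, then \<open>h k\<close> times the invariant cochain \<open>sign_cup h k\<close>,
  summed over a simplex and its image, leaves \<open>sign_cup h k\<close>. The sign is invisible mod 2.
\<close>

lemma cochain_eval_antipodal:
  assumes "singular_chain k X c"
    and odd: "\<And>j x. j \<le> k \<Longrightarrow> x \<in> topspace X \<Longrightarrow> h j (a x) = h j x + 1"
  shows "cochain_eval (\<lambda>s. h k (simplex_vertices s 0) * sign_cup h k (simplex_vertices s)) 
          (c + frag_cmul ((-1)^l) (chain_map k a c))
      = cochain_eval (\<lambda>s. sign_cup h k (simplex_vertices s)) c"
  using assms(1) unfolding singular_chain_def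
proof (induction c rule: frag_induction)
  case (one s)
  then have s: "singular_simplex k X s" by simp
  have "sign_cup h k (simplex_vertices (simplex_map k a s)) = sign_cup h k (\<lambda>i. a (simplex_vertices s i))"
    by (rule sign_cup_cong) (simp add: vertices_simplex_map)
  also have "\<dots> = sign_cup h k (simplex_vertices s)"
    by (rule sign_cup_antipodal) (auto intro!: odd vertex_in_topspace[OF s])
  finally have 1: "sign_cup h k (simplex_vertices (simplex_map k a s)) = sign_cup h k (simplex_vertices s)" .
  have 2: "h k (simplex_vertices (simplex_map k a s) 0) = h k (simplex_vertices s 0) + 1"
    using odd[of k "simplex_vertices s 0"] vertex_in_topspace[OF s, of 0] by (simp add: vertices_simplex_map)
  show ?case
    by (simp add: cochain_eval_add cochain_eval_cmul bit_of_int_sign 1 2 algebra_simps bit_add_self del: of_int_power)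
next
  case (diff c d)
  have "c - d + frag_cmul ((-1)^l) (chain_map k a (c - d)) = 
    (c + frag_cmul ((-1)^l) (chain_map k a c)) - (d + frag_cmul ((-1)^l) (chain_map k a d))"
    using frag_cmul_distrib2[of "(-1)^l" "chain_map k a (c - d)" "chain_map k a d"]
    by (simp add: chain_map_diff algebra_simps)
  then show ?case by (simp only: cochain_eval_diff diff)
qed simp

section \<open>Hemisphere chains from the homology of the sphere\<close>

lemma nsphere_0_chains_homologous:
  assumes n: "n > 0" and f: "singular_simplex 0 (nsphere n) f" and g: "singular_simplex 0 (nsphere n) g"
  shows "singular_relboundary 0 (nsphere n) {} (frag_of f - frag_of g)"
proof -
  let ?X = "nsphere n" and ?D = "discrete_topology {()}" and ?c = "frag_of f - frag_of g"
  have c: "singular_relcycle 0 ?X {} ?c"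
    using f g by (simp add: singular_cycle singular_chain_diff singular_chain_of chain_boundary_def)
  \<comment> \<open>Collapsing the sphere to a point kills the difference, so its class lies in
    reduced homology, which vanishes in degree 0 because \<open>n > 0\<close>.\<close>
  have "simplex_map 0 (\<lambda>x. ()) f = simplex_map 0 (\<lambda>x. ()) g"
    by (simp add: simplex_map_def)
  then have 0: "chain_map 0 (\<lambda>x. ()) ?c = 0"
    by (simp add: chain_map_diff)
  have "hom_induced (int 0) ?X {} ?D {} (\<lambda>x. ()) (homologous_rel_set 0 ?X {} ?c)
      = homologous_rel_set 0 ?D {} (chain_map 0 (\<lambda>x. ()) ?c)"
    by (rule hom_induced_chain_map) (use c in auto)
  also have "\<dots> = singular_relboundary_set 0 ?D {}"
    unfolding 0 homologous_rel_set_eq_relboundary by simp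
  finally have "homologous_rel_set 0 ?X {} ?c \<in> carrier (reduced_homology_group (int 0) ?X)"
    unfolding carrier_reduced_homology_group kernel_def carrier_relative_homology_group one_relative_homology_group
    using c by blast
  moreover have "trivial_group (reduced_homology_group (int 0) ?X)"
    using n by (simp add: trivial_reduced_homology_group_nsphere)
  ultimately have "homologous_rel_set 0 ?X {} ?c = \<one>\<^bsub>reduced_homology_group (int 0) ?X\<^esub>"
    by (simp add: trivial_group_def)
  also have "\<dots> = singular_relboundary_set 0 ?X {}"
    unfolding reduced_homology_group_def by (metis one_relative_homology_group one_subgroup_generated)
  finally show ?thesis
    by (simp only: homologous_rel_set_eq_relboundary)
qed

lemma nsphere_cycle_bounds:
  assumes p: "0 < p" "p < n" and c: "singular_relcycle p (nsphere n) {} c"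
  shows "singular_relboundary p (nsphere n) {} c"
proof -
  have "trivial_group (homology_group (int p) (nsphere n))"
    using trivial_reduced_homology_group_nsphere[of "int p" n] p by (simp add: un_reduced_homology_group)
  moreover have "homologous_rel_set p (nsphere n) {} c \<in> carrier (homology_group (int p) (nsphere n))"
    using c by (simp add: carrier_relative_homology_group)
  ultimately have "homologous_rel_set p (nsphere n) {} c = singular_relboundary_set p (nsphere n) {}"
    by (simp add: trivial_group_def)
  then show ?thesis
    by (simp only: homologous_rel_set_eq_relboundary)
qed

definition antipode :: "('i \<Rightarrow> real) \<Rightarrow> 'i \<Rightarrow> real"
  where "antipode x = (\<lambda>i. - x i)"

lemma antipode_antipode [simp]: "antipode (antipode x) = x"
  by (simp add: antipode_def)

lemma continuous_map_antipode: "continuous_map (nsphere n) (nsphere n) antipode"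
proof -
  have "continuous_map (nsphere n) (powertop_real UNIV) antipode"
    unfolding antipode_def continuous_map_componentwise_UNIV
    using continuous_map_nsphere_projection continuous_map_minus by blast
  moreover have "antipode x \<in> {x. (\<Sum>i\<le>n. (x i)\<^sup>2) = 1 \<and> (\<forall>i>n. x i = 0)}" 
    if "x \<in> topspace (nsphere n)" for x
    using that by (auto simp: nsphere antipode_def)
  ultimately show ?thesis
    by (subst (2) nsphere) (auto simp: continuous_map_in_subtopology)
qed

text \<open>
  On the sphere with the antipodal map, \<open>c k\<close> plays the role of a \<open>k\<close>-dimensional hemisphere:
  its boundary is the sphere made of the two opposite hemispheres \<open>c (k - 1)\<close>.
\<close>

definition hemisphere_chains :: "nat \<Rightarrow> 'a topology \<Rightarrow> ('a \<Rightarrow> 'a) \<Rightarrow> (nat \<Rightarrow> 'a chain) \<Rightarrow> bool"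
  where "hemisphere_chains n X a c \<longleftrightarrow>
    (\<exists>f. c 0 = frag_of f) \<and> (\<forall>k\<le>n. singular_chain k X (c k)) \<and>
    (\<forall>k<n. chain_boundary (Suc k) (c (Suc k)) = c k + frag_cmul ((-1) ^ Suc k) (chain_map k a (c k)))"

text \<open>A hemisphere plus its signed antipode is a cycle of dimension \<open>m < n\<close>,
  hence bounds in the \<open>n\<close>-sphere (in dimension 0, as a difference of two points); any
  chain with that boundary serves as the next hemisphere.\<close>

lemma hemisphere_chains_exist:
  "\<exists>c. hemisphere_chains n (nsphere n) antipode c"
proof -
  have "m \<le> n \<Longrightarrow> \<exists>c. hemisphere_chains m (nsphere n) antipode c" for m
  proof (induction m)
    case 0
    let ?f = "restrict (\<lambda>x. \<lambda>i. if i = 0 then 1 else 0) (standard_simplex 0) :: (nat \<Rightarrow> real) \<Rightarrow> nat \<Rightarrow> real"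
    have "singular_simplex 0 (nsphere n) ?f"
      using in_topspace_nsphere[of n] by (simp add: singular_simplex_def)
    then show ?case
      by (intro exI[of _ "\<lambda>_. frag_of ?f"]) (auto simp: hemisphere_chains_def singular_chain_of)
  next
    case (Suc m)
    let ?X = "nsphere n"
    let ?s = "\<lambda>k. (-1 :: int) ^ k"
    let ?a = "\<lambda>k. chain_map k antipode"
    obtain c where c: "hemisphere_chains m ?X antipode c"
      using Suc by auto
    then have cm: "singular_chain k ?X (c k)" if "k \<le> m" for k
      using that by (simp add: hemisphere_chains_def)
    define z where "z = c m + frag_cmul (?s (Suc m)) (?a m (c m))"
    have am: "singular_chain m ?X (?a m (c m))"
      using cm[of m] singular_chain_chain_map continuous_map_antipode by blast
    have "singular_relboundary m ?X {} z"
    proof (cases m)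
      case 0
      then obtain f where f: "c 0 = frag_of f"
        using c by (auto simp: hemisphere_chains_def)
      then have "singular_simplex 0 ?X f"
        using cm[of 0] by (simp add: singular_chain_of)
      moreover from this have "singular_simplex 0 ?X (simplex_map 0 antipode f)"
        using singular_simplex_simplex_map continuous_map_antipode by blast
      ultimately show ?thesis
        using nsphere_0_chains_homologous[of n f "simplex_map 0 antipode f"] Suc.prems
        by (simp add: z_def 0 f)
    next
      case (Suc l)
      have cl: "singular_chain l ?X (c l)" using cm[of l] Suc by simp
      have b: "chain_boundary m (c m) = c l + frag_cmul (?s m) (?a l (c l))"
        using c Suc by (simp add: hemisphere_chains_def)
      have aa: "?a l (?a l (c l)) = c l"
        using chain_map_compose[of l antipode antipode] chain_map_id_gen[OF cl, of "antipode \<circ> antipode"]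
        by (metis comp_apply antipode_antipode)
      have "chain_boundary m (?a m (c m)) = ?a l (chain_boundary m (c m))"
        using chain_boundary_chain_map[OF cm[of m]] Suc by simp
      also have "\<dots> = ?a l (c l) + frag_cmul (?s m) (c l)"
        by (simp only: b chain_map_add chain_map_cmul aa)
      finally have "chain_boundary m z = 
          c l + frag_cmul (?s m) (?a l (c l)) + frag_cmul (?s (Suc m)) (?a l (c l) + frag_cmul (?s m) (c l))"
        by (simp only: z_def chain_boundary_add chain_boundary_cmul b)
      \<comment> \<open>Successive signs are opposite, so the antipodal terms cancel; their product
        is -1, which cancels \<open>c l\<close>.\<close>
      also have "\<dots> = 0"
        by (cases "even m") (auto simp: frag_cmul_distrib2 algebra_simps)
      finally have "singular_relcycle m ?X {} z"
        unfolding singular_cycle z_def using cm[of m] am by (auto intro!: singular_chain_add singular_chain_cmul)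
      then show ?thesis
        using nsphere_cycle_bounds[of m n z] Suc.prems Suc by simp
    qed
    then obtain d where d: "singular_chain (Suc m) ?X d" "chain_boundary (Suc m) d = z"
      by (auto simp: singular_boundary)
    define c' where "c' = c(Suc m := d)"
    have "hemisphere_chains (Suc m) ?X antipode c'"
      using c d unfolding hemisphere_chains_def c'_def z_def by (auto simp: le_Suc_eq less_Suc_eq)
    then show ?case by blast
  qed
  then show ?thesis by blast
qed

text \<open>Subdivision commutes with boundaries and with the chain map of \<open>a\<close>, and it
  fixes 0-chains.\<close>

lemma hemisphere_chains_subdivision:
  assumes c: "hemisphere_chains n X a c"
  shows "hemisphere_chains n X a (\<lambda>k. singular_subdivision k (c k))"
  unfolding hemisphere_chains_def
proof (intro conjI allI impI)
  have c0: "singular_chain 0 X (c 0)" using c by (simp add: hemisphere_chains_def)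
  then show "\<exists>f. singular_subdivision 0 (c 0) = frag_of f"
    using c by (simp add: hemisphere_chains_def singular_subdivision_zero[OF c0])
  show "singular_chain k X (singular_subdivision k (c k))" if "k \<le> n" for k
    using that c by (simp add: hemisphere_chains_def singular_chain_singular_subdivision)
  fix k assume k: "k < n"
  have cmul: "singular_subdivision k (frag_cmul b x) = frag_cmul b (singular_subdivision k x)" for b x
    by (simp add: singular_subdivision_def frag_extend_cmul)
  have ck: "singular_chain k X (c k)" "singular_chain (Suc k) X (c (Suc k))"
    using k c by (simp_all add: hemisphere_chains_def)
  have "chain_boundary (Suc k) (singular_subdivision (Suc k) (c (Suc k))) = 
      singular_subdivision k (c k + frag_cmul ((-1) ^ Suc k) (chain_map k a (c k)))"
    using chain_boundary_singular_subdivision[OF ck(2)] c k by (simp add: hemisphere_chains_def)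
  then show "chain_boundary (Suc k) (singular_subdivision (Suc k) (c (Suc k))) =
      singular_subdivision k (c k) + frag_cmul ((-1) ^ Suc k) (chain_map k a (singular_subdivision k (c k)))"
    by (simp only: singular_subdivision_add cmul naturality_singular_subdivision[OF ck(1)])
qed

lemma hemisphere_chains_iterated_subdivision:
  "hemisphere_chains n X a c \<Longrightarrow> hemisphere_chains n X a (\<lambda>k. (singular_subdivision k ^^ m) (c k))"
  by (induction m) (use hemisphere_chains_subdivision in fastforce)+

text \<open>The boundary formula moves the evaluation from \<open>c (Suc k)\<close> to
  \<open>c k\<close> plus its signed antipode, and the antipodal formula reduces that to
  \<open>sign_cup h k\<close> on \<open>c k\<close>. The start is the empty product on a single
  point.\<close>

lemma sign_cup_hemisphere_chains:
  assumes c: "hemisphere_chains n X a c"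
    and odd: "\<And>j x. x \<in> topspace X \<Longrightarrow> h j (a x) = h j x + 1"
    and "k \<le> n"
  shows "cochain_eval (\<lambda>s. sign_cup h k (simplex_vertices s)) (c k) = 1"
  using \<open>k \<le> n\<close>
proof (induction k)
  case 0
  then show ?case using c by (auto simp: hemisphere_chains_def)
next
  case (Suc k)
  then have b: "chain_boundary (Suc k) (c (Suc k)) = c k + frag_cmul ((-1) ^ Suc k) (chain_map k a (c k))"
    and ck: "singular_chain k X (c k)"
    using c by (auto simp: hemisphere_chains_def)
  show ?case
    using cochain_eval_antipodal[of k X "c k" h a "Suc k", OF ck odd] Suc
    by (simp only: cochain_eval_boundary[of h k "c (Suc k)", symmetric] b)
qed

section \<open>Borsuk-Ulam for the standard sphere\<close>

theorem Borsuk_Ulam_nsphere: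
  fixes F :: "(nat \<Rightarrow> real) \<Rightarrow> nat \<Rightarrow> real"
  assumes cont: "\<And>i. i < n \<Longrightarrow> continuous_map (nsphere n) euclideanreal (\<lambda>x. F x i)"
    and odd: "\<And>x i. \<lbrakk>x \<in> topspace (nsphere n); i < n\<rbrakk> \<Longrightarrow> F (\<lambda>j. - x j) i = - F x i"
  shows "\<exists>x\<in>topspace (nsphere n). \<forall>i<n. F x i = 0"
proof (rule ccontr)
  assume "\<not> ?thesis"
  then have nz: "\<exists>i<n. F x i \<noteq> 0" if "x \<in> topspace (nsphere n)" for x
    using that by blast
  let ?X = "nsphere n"
  \<comment> \<open>\<open>U i e\<close> is where component \<open>i\<close> has the sign
    \<open>e\<close>. If the components never vanish together, these open sets cover the
    sphere.\<close>
  define U where "U i e = {x \<in> topspace ?X. e * F x i > 0}" for i and e :: real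
  define \<C> where "\<C> = (\<lambda>(i, e). U i e) ` ({..<n} \<times> {1, -1})"
  have "openin ?X (U i e)" if "i < n" for i e
  proof -
    have "continuous_map ?X euclideanreal (\<lambda>x. e * F x i)"
      by (intro continuous_map_real_mult continuous_map_const[THEN iffD2] cont that) simp
    then have "openin ?X {x \<in> topspace ?X. e * F x i \<in> {0<..}}"
      by (rule openin_continuous_map_preimage) auto
    then show ?thesis by (simp add: U_def)
  qed
  then have "\<And>V. V \<in> \<C> \<Longrightarrow> openin ?X V"
    by (auto simp: \<C>_def)
  moreover have "topspace ?X \<subseteq> \<Union>\<C>"
  proof
    fix x assume x: "x \<in> topspace ?X"
    then obtain i where i: "i < n" "F x i \<noteq> 0" using nz by blast
    then have "x \<in> U i 1 \<or> x \<in> U i (-1)" using x by (auto simp: U_def)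
    then show "x \<in> \<Union>\<C>" using i unfolding \<C>_def by force
  qed
  moreover obtain c where c: "hemisphere_chains n ?X antipode c"
    using hemisphere_chains_exist by blast
  moreover from c have cn: "singular_chain n ?X (c n)"
    by (simp add: hemisphere_chains_def)
  ultimately obtain m where
    m: "\<And>m' f. \<lbrakk>m \<le> m'; f \<in> Poly_Mapping.keys ((singular_subdivision n ^^ m') (c n))\<rbrakk>
          \<Longrightarrow> \<exists>V \<in> \<C>. f \<in> standard_simplex n \<rightarrow> V"
    using sufficient_iterated_singular_subdivision_exists[of \<C> ?X n "c n"] by metis
  \<comment> \<open>All chains are subdivided equally often, since the boundary relation ties
    consecutive dimensions together.\<close>
  define d where "d k = (singular_subdivision k ^^ m) (c k)" for k
  have d: "hemisphere_chains n ?X antipode d"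
    unfolding d_def by (rule hemisphere_chains_iterated_subdivision[OF c])
  \<comment> \<open>\<open>lead\<close> only serves to extend the sign of \<open>F x i\<close> to an odd function where \<open>F x i = 0\<close>.\<close>
  define lead :: "(nat \<Rightarrow> real) \<Rightarrow> real" where "lead x = x (LEAST i. x i \<noteq> 0)" for x
  define h :: "nat \<Rightarrow> (nat \<Rightarrow> real) \<Rightarrow> bit"
    where "h i x = (if i < n \<and> F x i \<noteq> 0 then of_bool (F x i > 0) else of_bool (lead x > 0))" for i x
  have lead: "lead (antipode x) = - lead x" for x
    by (simp add: lead_def antipode_def)
  have lead0: "lead x \<noteq> 0" if "x \<in> topspace ?X" for x
  proof -
    have "\<exists>i. x i \<noteq> 0" using that by (auto simp: nsphere intro: ccontr)
    then show ?thesis unfolding lead_def by (rule LeastI_ex)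
  qed
  have h: "h j (antipode x) = h j x + 1" if "x \<in> topspace ?X" for j x
    using lead[of x] lead0[OF that] odd[OF that, of j] by (auto simp: h_def antipode_def)
  have "sign_cup h n (simplex_vertices s) = 0" if "s \<in> Poly_Mapping.keys (d n)" for s
  proof -
    have "s \<in> Poly_Mapping.keys ((singular_subdivision n ^^ m) (c n))"
      using that by (simp add: d_def)
    then obtain V where V: "V \<in> \<C>" "s \<in> standard_simplex n \<rightarrow> V"
      using m[OF order_refl] by blast
    then obtain i e where i: "i < n" "e \<in> {1, -1}" "V = U i e"
      by (auto simp: \<C>_def)
    have hV: "h i x = of_bool (e > 0)" if "x \<in> V" for x
      using that i by (auto simp: h_def U_def)
    have sV: "simplex_vertices s l \<in> V" if "l \<le> n" for l
      using V(2) that by (auto simp: simplex_vertices_def)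
    \<comment> \<open>As \<open>h i\<close> is constant on \<open>V\<close>, the factor built from
      \<open>h i\<close> is zero; the recursion reaches that factor because
      \<open>i < k\<close>.\<close>
    have "sign_cup h k v = 0" if "i < k" "\<And>l. l \<le> k \<Longrightarrow> v l \<in> V" for k v
      using that
    proof (induction k arbitrary: v)
      case (Suc k)
      show ?case
      proof (cases "i = k")
        case True
        have "v 0 \<in> V" "v 1 \<in> V" using Suc.prems(2) by auto
        then have "h k (v 0) = h k (v 1)" using hV True by simp
        then show ?thesis by (simp add: bit_add_self)
      next
        case False
        then have "sign_cup h k (v \<circ> Suc) = 0" using Suc by simp
        then show ?thesis by simp
      qed
    qed simp
    then show ?thesis using i sV by blast
  qed
  then have "cochain_eval (\<lambda>s. sign_cup h n (simplex_vertices s)) (d n) = 0"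
    by (simp add: cochain_eval_def)
  moreover have "cochain_eval (\<lambda>s. sign_cup h n (simplex_vertices s)) (d n) = 1"
    by (rule sign_cup_hemisphere_chains[OF d]) (use h in auto)
  ultimately show False by simp
qed

section \<open>Transfer to finitely supported functions\<close>

lemma nsphere_top_of_set:
  "nsphere n = top_of_set {x. (\<Sum>i\<le>n. (x i)\<^sup>2) = 1 \<and> (\<forall>i>n. x i = 0)}"
  by (simp add: nsphere euclidean_product_topology)

text \<open>An enumeration of \<open>I\<close> carries the sphere of dimension
  \<open>card I - 1\<close> into the nonzero functions supported on \<open>I\<close>, where
  \<open>F\<close> is defined.\<close>

theorem Borsuk_Ulam_finite_support:
  fixes F :: "('i \<Rightarrow> real) \<Rightarrow> nat \<Rightarrow> real"
  assumes I: "finite I" "r < card I"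
    and cont: "\<And>s. s < r \<Longrightarrow> continuous_on {x. (\<forall>i. i \<notin> I \<longrightarrow> x i = 0) \<and> x \<noteq> (\<lambda>_. 0)} (\<lambda>x. F x s)"
    and odd: "\<And>x s. \<lbrakk>\<forall>i. i \<notin> I \<longrightarrow> x i = 0; x \<noteq> (\<lambda>_. 0); s < r\<rbrakk> \<Longrightarrow> F (\<lambda>i. - x i) s = - F x s"
  shows "\<exists>x. (\<forall>i. i \<notin> I \<longrightarrow> x i = 0) \<and> x \<noteq> (\<lambda>_. 0) \<and> (\<forall>s<r. F x s = 0)"
proof -
  define n where "n = card I - 1"
  have n: "card I = Suc n" "r \<le> n" using I(2) by (auto simp: n_def)
  obtain e where e: "bij_betw e I {0..<card I}"
    using ex_bij_betw_finite_nat[OF I(1)] by blast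
  define G :: "(nat \<Rightarrow> real) \<Rightarrow> 'i \<Rightarrow> real" where "G x = (\<lambda>i. if i \<in> I then x (e i) else 0)" for x
  let ?S = "{x. (\<Sum>i\<le>n. (x i)\<^sup>2) = 1 \<and> (\<forall>i>n. x i = 0)} :: (nat \<Rightarrow> real) set"
  let ?Z = "{x. (\<forall>i. i \<notin> I \<longrightarrow> x i = 0) \<and> x \<noteq> (\<lambda>_. 0)} :: ('i \<Rightarrow> real) set"
  have GZ: "G x \<in> ?Z" if "x \<in> ?S" for x
  proof -
    have "\<exists>j\<le>n. x j \<noteq> 0"
      using that by (force intro: ccontr)
    then obtain j where j: "j \<le> n" "x j \<noteq> 0" by blast
    then obtain i where "i \<in> I" "e i = j"
      using e n by (metis atLeast0LessThan bij_betw_imp_surj_on imageE lessThan_iff less_Suc_eq_le)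
    then have "G x i \<noteq> 0" using j by (simp add: G_def)
    then have "G x \<noteq> (\<lambda>_. 0)" by auto
    then show ?thesis by (simp add: G_def)
  qed
  have contG: "continuous_on A G" for A
    unfolding G_def
  proof (intro continuous_on_coordinatewise_then_product)
    show "continuous_on A (\<lambda>x. if i \<in> I then x (e i) else 0)" for i
      by (cases "i \<in> I") (auto intro: continuous_on_subset[OF continuous_on_product_coordinates])
  qed
  \<comment> \<open>The sphere theorem asks for exactly \<open>n\<close> components; those from
    \<open>r\<close> on are set to zero.\<close>
  have "\<exists>x\<in>topspace (nsphere n). \<forall>s<n. (if s < r then F (G x) s else 0) = 0"
  proof (rule Borsuk_Ulam_nsphere[where F = "\<lambda>x s. if s < r then F (G x) s else 0"])
    show "continuous_map (nsphere n) euclideanreal (\<lambda>x. if s < r then F (G x) s else 0)" for s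
    proof (cases "s < r")
      case True
      have "continuous_on ?S (\<lambda>x. F (G x) s)"
        by (rule continuous_on_compose2[OF cont[OF True] contG]) (rule image_subsetI, rule GZ)
      then show ?thesis using True by (simp add: nsphere_top_of_set)
    qed simp
    fix x s assume "x \<in> topspace (nsphere n)"
    then have "x \<in> ?S" by (simp add: nsphere_top_of_set)
    from GZ[OF this] have "F (\<lambda>i. - G x i) s = - F (G x) s" if "s < r"
      using odd[of "G x" s] that by blast
    moreover have "G (\<lambda>j. - x j) = (\<lambda>i. - G x i)"
      by (auto simp: G_def)
    ultimately show "(if s < r then F (G (\<lambda>j. - x j)) s else 0) = - (if s < r then F (G x) s else 0)"
      by simp
  qed
  then obtain x where x: "x \<in> ?S" "\<forall>s<n. (if s < r then F (G x) s else 0) = 0"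
    by (auto simp: nsphere_top_of_set)
  from x(2) n(2) have "\<forall>s<r. F (G x) s = 0"
    by (metis order_less_le_trans)
  with GZ[OF x(1)] show ?thesis by blast
qed

text \<open>Linear functionals are odd and continuous, so Borsuk-Ulam solves underdetermined systems
  nontrivially.\<close>

lemma homogeneous_system_solution:
  fixes b :: "nat \<Rightarrow> 'i \<Rightarrow> real"
  assumes "finite I" "r < card I"
  shows "\<exists>g. (\<forall>i. i \<notin> I \<longrightarrow> g i = 0) \<and> (\<exists>i\<in>I. g i \<noteq> 0) \<and> (\<forall>s<r. (\<Sum>i\<in>I. b s i * g i) = 0)"
proof -
  have "\<exists>g. (\<forall>i. i \<notin> I \<longrightarrow> g i = 0) \<and> g \<noteq> (\<lambda>_. 0) \<and> (\<forall>s<r. (\<Sum>i\<in>I. b s i * g i) = 0)"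
    by (rule Borsuk_Ulam_finite_support[OF assms])
       (auto simp: sum_negf intro!: continuous_intros continuous_on_subset[OF continuous_on_product_coordinates])
  then obtain g where g: "\<forall>i. i \<notin> I \<longrightarrow> g i = 0" "g \<noteq> (\<lambda>_. 0)" "\<forall>s<r. (\<Sum>i\<in>I. b s i * g i) = 0"
    by blast
  then have "\<exists>i\<in>I. g i \<noteq> 0" by fastforce
  with g show ?thesis by blast
qed

section \<open>The Krasnoselskii genus of symmetric sets\<close>

lemma odd_map_vanishes:
  fixes F :: "(nat \<Rightarrow> real) \<Rightarrow> nat \<Rightarrow> real"
  assumes "k \<le> kgenus B" "r < k"
    and "\<And>s. s < r \<Longrightarrow> continuous_on B (\<lambda>x. F x s)"
    and "\<And>x s. \<lbrakk>x \<in> B; s < r\<rbrakk> \<Longrightarrow> F (\<lambda>i. - x i) s = - F x s"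
  shows "\<exists>x\<in>B. \<forall>s<r. F x s = 0"
proof (rule ccontr)
  assume not: "\<not> ?thesis"
  \<comment> \<open>Without a common zero, padding the components with zeros gives an odd map into
    punctured \<open>r\<close>-space, which forces the genus to be at most \<open>r\<close>.\<close>
  let ?g = "\<lambda>x s. if s < r then F x s else 0"
  have "continuous_on B ?g"
  proof (rule continuous_on_coordinatewise_then_product)
    show "continuous_on B (\<lambda>x. if s < r then F x s else 0)" for s
      using assms(3) by (cases "s < r") auto
  qed
  moreover have "?g (\<lambda>i. - x i) = (\<lambda>s. - ?g x s)" if "x \<in> B" for x
    using assms(4)[OF that] by (auto simp: fun_eq_iff)
  moreover have "\<exists>s<r. ?g x s \<noteq> 0" if "x \<in> B" for x
    using not that by auto
  ultimately have "odd_map_to_sphere B r"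
    unfolding odd_map_to_sphere_def by (intro exI[of _ ?g]) auto
  then have "kgenus B \<le> r"
    unfolding kgenus_def by (rule Least_le)
  with assms(1,2) show False by simp
qed

lemma sphere_p_nonzero:
  assumes "x \<in> sphere_p n mu p"
  shows "\<exists>i\<in>{1..n}. x i \<noteq> 0"
proof (rule ccontr)
  assume "\<not> ?thesis"
  then have "(\<Sum>i=1..n. mu i * \<bar>x i\<bar> powr p) = 0"
    by (intro sum.neutral) auto
  then show False using assms by (simp add: sphere_p_def)
qed

text \<open>An odd map of the \<open>p\<close>-sphere into a punctured space of dimension below
  \<open>n\<close>, precomposed with radial projection, would contradict Borsuk-Ulam on the nonzero
  functions on \<open>n\<close> points.\<close>

lemma kgenus_sphere_p:
  assumes mu: "\<And>i. i \<in> {1..n} \<Longrightarrow> mu i > 0" and p: "p \<ge> 1"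
  shows "n \<le> kgenus (sphere_p n mu p)"
proof (rule ccontr)
  let ?S = "sphere_p n mu p"
  assume "\<not> ?thesis"
  then have less: "kgenus ?S < n" by simp
  \<comment> \<open>The genus is a \<open>LEAST\<close>, so it is attained once some odd map is
    exhibited; the coordinates, shifted to start at 0, provide one.\<close>
  have "odd_map_to_sphere ?S n"
    unfolding odd_map_to_sphere_def
  proof (intro exI[of _ "\<lambda>x i. if i < n then x (Suc i) else 0"] conjI ballI)
    show "continuous_on ?S (\<lambda>x i. if i < n then x (Suc i) else 0)"
    proof (rule continuous_on_coordinatewise_then_product)
      show "continuous_on ?S (\<lambda>x. if i < n then x (Suc i) else 0)" for i
        by (cases "i < n") (auto intro: continuous_on_subset[OF continuous_on_product_coordinates])
    qed
    fix x assume "x \<in> ?S"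
    from sphere_p_nonzero[OF this] obtain i where "i \<in> {1..n}" "x i \<noteq> 0" by blast
    then have "i - 1 < n" "x (Suc (i - 1)) \<noteq> 0" by auto
    then show "\<exists>i<n. (if i < n then x (Suc i) else 0) \<noteq> 0" by metis
  qed auto
  then have "odd_map_to_sphere ?S (kgenus ?S)"
    unfolding kgenus_def by (rule LeastI)
  then obtain g :: "(nat \<Rightarrow> real) \<Rightarrow> nat \<Rightarrow> real"
    where "continuous_on ?S g \<and> (\<forall>x\<in>?S. g (\<lambda>i. - x i) = (\<lambda>i. - g x i)) \<and>
      (\<forall>x\<in>?S. (\<forall>i\<ge>kgenus ?S. g x i = 0) \<and> (\<exists>i<kgenus ?S. g x i \<noteq> 0))"
    unfolding odd_map_to_sphere_def by (rule exE)
  then have g: "continuous_on ?S g" "\<And>x. x \<in> ?S \<Longrightarrow> g (\<lambda>i. - x i) = (\<lambda>i. - g x i)"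
      "\<And>x. x \<in> ?S \<Longrightarrow> \<exists>i<kgenus ?S. g x i \<noteq> 0"
    by simp_all
  define N where "N x = (\<Sum>i=1..n. mu i * \<bar>x i\<bar> powr p)" for x :: "nat \<Rightarrow> real"
  \<comment> \<open>The exponent is \<open>1/p\<close> because \<open>N\<close> is homogeneous of
    degree \<open>p\<close>.\<close>
  define \<pi> where "\<pi> x = (\<lambda>i. x i / N x powr (1/p))" for x :: "nat \<Rightarrow> real"
  let ?Z = "{x. (\<forall>i. i \<notin> {1..n} \<longrightarrow> x i = 0) \<and> x \<noteq> (\<lambda>_. 0)} :: (nat \<Rightarrow> real) set"
  have Npos: "N x > 0" if x: "x \<in> ?Z" for x
  proof -
    obtain i where "i \<in> {1..n}" "x i \<noteq> 0" using x by fastforce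
    then show ?thesis
      unfolding N_def using mu by (intro sum_pos2[of _ i]) (auto simp: less_imp_le)
  qed
  have \<pi>S: "\<pi> x \<in> ?S" if x: "x \<in> ?Z" for x
  proof -
    have "(\<Sum>i=1..n. mu i * \<bar>\<pi> x i\<bar> powr p) = (\<Sum>i=1..n. mu i * \<bar>x i\<bar> powr p / N x)"
      using Npos[OF x] p by (intro sum.cong) (auto simp: \<pi>_def powr_divide powr_powr abs_divide)
    also have "\<dots> = 1"
      using Npos[OF x] by (simp add: N_def flip: sum_divide_distrib)
    finally show ?thesis using x by (auto simp: sphere_p_def vfuns_def \<pi>_def)
  qed
  have contN: "continuous_on A N" for A
    unfolding N_def using p
    by (intro continuous_on_sum continuous_on_mult_left continuous_on_powr' continuous_on_rabs continuous_on_const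
        continuous_on_subset[OF continuous_on_product_coordinates]) auto
  have cont\<pi>: "continuous_on ?Z \<pi>"
    unfolding \<pi>_def
  proof (rule continuous_on_coordinatewise_then_product)
    fix i show "continuous_on ?Z (\<lambda>x. x i / N x powr (1/p))"
    proof (intro continuous_on_divide continuous_on_powr contN continuous_on_const
        continuous_on_subset[OF continuous_on_product_coordinates] subset_UNIV)
      have nz: "N x \<noteq> 0" if "x \<in> ?Z" for x
        using Npos[OF that] by simp
      show "\<forall>x\<in>?Z. N x \<noteq> 0" "\<forall>x\<in>?Z. N x powr (1/p) \<noteq> 0"
        unfolding powr_eq_0_iff by (rule ballI, erule nz)+
    qed (use p in auto)
  qed
  have "\<exists>x. (\<forall>i. i \<notin> {1..n} \<longrightarrow> x i = 0) \<and> x \<noteq> (\<lambda>_. 0) \<and> (\<forall>s<kgenus ?S. g (\<pi> x) s = 0)"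
  proof (rule Borsuk_Ulam_finite_support)
    show "finite {1..n}" "kgenus ?S < card {1..n}" using less by auto
    show "continuous_on ?Z (\<lambda>x. g (\<pi> x) s)" for s
      by (rule continuous_on_compose2[OF continuous_on_product_then_coordinatewise[OF g(1)] cont\<pi>])
         (rule image_subsetI, rule \<pi>S)
    fix x :: "nat \<Rightarrow> real" and s 
    assume "\<forall>i. i \<notin> {1..n} \<longrightarrow> x i = 0" "x \<noteq> (\<lambda>_. 0)"
    then have "\<pi> x \<in> ?S" using \<pi>S by blast
    moreover have "\<pi> (\<lambda>i. - x i) = (\<lambda>i. - \<pi> x i)"
      by (simp add: \<pi>_def N_def)
    ultimately show "g (\<pi> (\<lambda>i. - x i)) s = - g (\<pi> x) s"
      using g(2) by simp
  qed
  then obtain x where "x \<in> ?Z" "\<forall>s<kgenus ?S. g (\<pi> x) s = 0" by blast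
  then show False using g(3)[OF \<pi>S] by blast
qed

text \<open>This member makes the infimum in \<open>lambda_p\<close> range over a nonempty
  family.\<close>

lemma sphere_p_in_Fk:
  assumes mu: "\<And>i. i \<in> {1..n} \<Longrightarrow> mu i > 0" and p: "p \<ge> 1" and "k \<le> n"
  shows "sphere_p n mu p \<in> Fk n mu p k"
proof -
  have "closed (sphere_p n mu p)"
  proof -
    have "sphere_p n mu p = (\<Inter>i\<in>-{1..n}. {x. x i = 0}) \<inter> {x. (\<Sum>i=1..n. mu i * \<bar>x i\<bar> powr p) = 1}"
      by (auto simp: sphere_p_def vfuns_def)
    also have "closed \<dots>"
      using p by (intro closed_Int closed_INT ballI closed_Collect_eq continuous_on_const continuous_on_sum 
          continuous_on_mult_left continuous_on_powr' continuous_on_rabs continuous_on_product_coordinates) auto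
    finally show ?thesis .
  qed
  moreover have "kgenus (sphere_p n mu p) \<ge> k"
    using kgenus_sphere_p[OF mu p] \<open>k \<le> n\<close> by fastforce
  ultimately show ?thesis
    by (auto simp: Fk_def sphere_p_def vfuns_def)
qed

section \<open>Successive minimization of a quadratic form\<close>

text \<open>For small \<open>t\<close> of sign opposite to \<open>b\<close> the linear term
  dominates; \<open>t = - b / (\<bar>c\<bar> + 1)\<close> is small enough, and the 1 keeps the
  divisor positive.\<close>

lemma linear_coeff_zero:
  fixes b c :: real
  assumes "\<And>t. 0 \<le> 2 * t * b + t\<^sup>2 * c"
  shows "b = 0"
proof (rule ccontr)
  assume b: "b \<noteq> 0"
  define D where "D = \<bar>c\<bar> + 1"
  define t where "t = - b / D"
  have D: "D > 0" "c \<le> D" by (auto simp: D_def)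
  have "t * D = - b" using D by (simp add: t_def)
  then have tD: "t\<^sup>2 * D = - (t * b)" by (simp add: power2_eq_square mult.assoc)
  have "2 * t * b + t\<^sup>2 * c \<le> 2 * t * b + t\<^sup>2 * D"
    using D by (intro add_left_mono mult_left_mono) auto
  also have "\<dots> = - (b\<^sup>2) / D"
    unfolding tD by (simp add: t_def power2_eq_square)
  also have "\<dots> < 0" using b D by (simp add: divide_neg_pos)
  finally show False using assms[of t] by simp
qed

text \<open>The matrix \<open>diag(mu)^{-1} a\<close> need not be symmetric, but it is self-adjoint
  for the inner product weighted by \<open>mu\<close>.\<close>

locale symmetric_form =
  fixes I :: "'i set" and mu :: "'i \<Rightarrow> real" and a :: "'i \<Rightarrow> 'i \<Rightarrow> real"
  assumes finite_I: "finite I"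
    and mu_pos: "\<And>i. i \<in> I \<Longrightarrow> mu i > 0"
    and a_sym: "\<And>i j. a i j = a j i"
begin

definition ip :: "('i \<Rightarrow> real) \<Rightarrow> ('i \<Rightarrow> real) \<Rightarrow> real"
  where "ip f g = (\<Sum>i\<in>I. mu i * f i * g i)"

definition form :: "('i \<Rightarrow> real) \<Rightarrow> ('i \<Rightarrow> real) \<Rightarrow> real"
  where "form f g = (\<Sum>i\<in>I. \<Sum>j\<in>I. a i j * f i * g j)"

lemma ip_commute: "ip f g = ip g f"
  by (simp add: ip_def mult_ac)

lemma form_commute: "form f g = form g f"
  unfolding form_def by (subst sum.swap) (simp add: a_sym[of _ "_ :: 'i"] mult_ac)

lemma ip_add_right: "ip f (\<lambda>i. g i + h i) = ip f g + ip f h"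
  by (simp add: ip_def algebra_simps sum.distrib)

lemma ip_add_left: "ip (\<lambda>i. g i + h i) f = ip g f + ip h f"
  by (simp add: ip_def algebra_simps sum.distrib)

lemma ip_scale_left: "ip (\<lambda>i. c * g i) f = c * ip g f"
  by (simp add: ip_def algebra_simps sum_distrib_left)

lemma ip_scale_right: "ip f (\<lambda>i. c * g i) = c * ip f g"
  by (simp add: ip_def algebra_simps sum_distrib_left)

lemma ip_sum_right: "ip f (\<lambda>i. \<Sum>s\<in>S. c s * u s i) = (\<Sum>s\<in>S. c s * ip f (u s))"
  unfolding ip_def sum_distrib_left by (subst sum.swap) (simp add: mult_ac)

lemma form_add_right: "form f (\<lambda>i. g i + h i) = form f g + form f h"
  by (simp add: form_def algebra_simps sum.distrib)

lemma form_add_left: "form (\<lambda>i. g i + h i) f = form g f + form h f"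
  by (simp add: form_def algebra_simps sum.distrib)

lemma form_scale_left: "form (\<lambda>i. c * g i) f = c * form g f"
  by (simp add: form_def algebra_simps sum_distrib_left)

lemma form_scale_right: "form f (\<lambda>i. c * g i) = c * form f g"
  by (simp add: form_def algebra_simps sum_distrib_left)

lemma form_sum_right: 
  assumes "finite S"
  shows "form f (\<lambda>i. \<Sum>s\<in>S. c s * u s i) = (\<Sum>s\<in>S. c s * form f (u s))"
  using assms
proof (induction S)
  case empty
  then show ?case by (simp add: form_def)
next
  case (insert s S)
  then show ?case by (simp add: form_add_right form_scale_right)
qed

lemma ip_nonneg: "0 \<le> ip f f"
  unfolding ip_def using mu_pos by (intro sum_nonneg) (simp add: mult.assoc less_imp_le)

lemma ip_eq_0D:
  assumes "ip f f = 0" "i \<in> I"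
  shows "f i = 0"
proof -
  have "mu i * f i * f i = 0"
    using assms mu_pos finite_I unfolding ip_def
    by (subst (asm) sum_nonneg_eq_0_iff) (auto simp: mult.assoc less_imp_le)
  then show ?thesis using mu_pos[OF assms(2)] by simp
qed

lemma ip_pos: "i \<in> I \<Longrightarrow> f i \<noteq> 0 \<Longrightarrow> 0 < ip f f"
  using ip_nonneg[of f] ip_eq_0D[of f i] by linarith

section \<open>Existence of successive minimizers\<close>

lemma compact_unit_sphere:
  "compact {g. (\<forall>i. i \<notin> I \<longrightarrow> g i = 0) \<and> ip g g = 1 \<and> (\<forall>s<r. ip (u s) g = 0)}" (is "compact ?K")
proof -
  \<comment> \<open>These compact intervals contain the coordinates of every unit vector:
    \<open>(g i)\<^sup>2 \<le> 1 / mu i\<close>, and \<open>1 + 1 / mu i\<close> exceeds the root of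
    the right side.\<close>
  define T where "T i = (if i \<in> I then {- (1 + 1 / mu i)..1 + 1 / mu i} else {0})" for i
  have "compactin (product_topology (\<lambda>i. euclidean) UNIV) (PiE UNIV T)"
    unfolding compactin_PiE by (auto simp: T_def)
  then have "compact (PiE UNIV T)"
    by (simp add: euclidean_product_topology)
  moreover have "closed {g. ip g g = 1}" "\<And>s. closed {g. ip (u s) g = 0}"
    unfolding ip_def
    by (intro closed_Collect_eq continuous_on_sum continuous_on_mult continuous_on_const continuous_on_product_coordinates)+
  then have "closed ({g. ip g g = 1} \<inter> (\<Inter>s\<in>{..<r}. {g. ip (u s) g = 0}))"
    by (intro closed_Int closed_INT) auto
  ultimately have "compact (PiE UNIV T \<inter> ({g. ip g g = 1} \<inter> (\<Inter>s\<in>{..<r}. {g. ip (u s) g = 0})))"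
    by (rule compact_Int_closed)
  moreover have "g i \<in> T i" if "ip g g = 1" "\<forall>i. i \<notin> I \<longrightarrow> g i = 0" for g i
  proof (cases "i \<in> I")
    case True
    have "mu i * g i * g i \<le> ip g g"
      unfolding ip_def using finite_I mu_pos True
      by (intro member_le_sum[where f = "\<lambda>i. mu i * g i * g i"]) (auto simp: mult.assoc less_imp_le)
    then have "(g i)\<^sup>2 \<le> 1 / mu i"
      using mu_pos[OF True] that by (simp add: field_simps power2_eq_square)
    also have "\<dots> \<le> (1 + 1 / mu i)\<^sup>2"
      using mu_pos[OF True] by (simp add: power2_eq_square field_simps)
    finally have "\<bar>g i\<bar> \<le> \<bar>1 + 1 / mu i\<bar>"
      by (simp only: abs_le_square_iff)
    moreover have "1 + 1 / mu i > 0"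
      using mu_pos[OF True] by (simp add: add_pos_pos)
    ultimately have "\<bar>g i\<bar> \<le> 1 + 1 / mu i"
      by simp
    then show ?thesis using True by (auto simp: T_def)
  qed (use that in \<open>auto simp: T_def\<close>)
  then have "?K = PiE UNIV T \<inter> ({g. ip g g = 1} \<inter> (\<Inter>s\<in>{..<r}. {g. ip (u s) g = 0}))"
    by (auto simp: PiE_iff T_def split: if_splits)
  ultimately show ?thesis by simp
qed

text \<open>Compactness gives a minimizer among unit vectors, and homogeneity of degree 2 extends
  its inequality to all admissible \<open>g\<close>. The bound on \<open>r\<close> ensures that some
  unit vector meets the constraints.\<close>

lemma constrained_minimizer:
  assumes "r < card I"
  shows "\<exists>x. ip x x = 1 \<and> (\<forall>s<r. ip (u s) x = 0) \<and>
    (\<forall>g. (\<forall>s<r. ip (u s) g = 0) \<longrightarrow> form x x * ip g g \<le> form g g)"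
proof -
  let ?K = "{g. (\<forall>i. i \<notin> I \<longrightarrow> g i = 0) \<and> ip g g = 1 \<and> (\<forall>s<r. ip (u s) g = 0)}"
  \<comment> \<open>Besides scaling, \<open>nrm\<close> cuts off outside \<open>I\<close>:
    competitors \<open>g\<close> are arbitrary there, while \<open>?K\<close> requires
    zeros.\<close>
  define nrm where "nrm g = (\<lambda>i. if i \<in> I then 1 / sqrt (ip g g) * g i else 0)" for g
  have ip_restrict: "ip f (\<lambda>i. if i \<in> I then g i else 0) = ip f g" for f g
    by (simp add: ip_def)
  have form_restrict: "form f (\<lambda>i. if i \<in> I then g i else 0) = form f g" for f g
    by (simp add: form_def)
  have ip_nrm: "ip f (nrm g) = 1 / sqrt (ip g g) * ip f g" for f g
    unfolding nrm_def ip_restrict ip_scale_right ..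
  have form_nrm: "form f (nrm g) = 1 / sqrt (ip g g) * form f g" for f g
    unfolding nrm_def form_restrict form_scale_right ..
  have ip_nrm_nrm: "ip (nrm g) (nrm g) = 1" if "ip g g > 0" for g
    using that ip_nrm[of "nrm g" g] ip_nrm[of g g] ip_commute[of "nrm g" g] by simp
  have form_nrm_nrm: "form (nrm g) (nrm g) = form g g / ip g g" if "ip g g > 0" for g
    using that form_nrm[of "nrm g" g] form_nrm[of g g] form_commute[of "nrm g" g] by simp
  have nrm_K: "nrm g \<in> ?K" if "ip g g > 0" "\<forall>s<r. ip (u s) g = 0" for g
    using that(2) ip_nrm_nrm[OF that(1)] ip_nrm by (simp add: nrm_def)
  obtain g where g: "\<exists>i\<in>I. g i \<noteq> 0" "\<forall>s<r. (\<Sum>i\<in>I. mu i * u s i * g i) = 0"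
    using homogeneous_system_solution[OF finite_I assms, of "\<lambda>s i. mu i * u s i"] by blast
  then have "nrm g \<in> ?K"
    using nrm_K[of g] ip_pos by (auto simp: ip_def)
  then have "?K \<noteq> {}" by blast
  moreover have "continuous_on ?K (\<lambda>g. form g g)"
    unfolding form_def
    by (intro continuous_on_sum continuous_on_mult continuous_on_const 
        continuous_on_subset[OF continuous_on_product_coordinates] subset_UNIV)
  ultimately have "\<exists>x\<in>?K. \<forall>g\<in>?K. form x x \<le> form g g"
    by (rule continuous_attains_inf[OF compact_unit_sphere])
  then obtain x where x: "x \<in> ?K" "\<forall>g\<in>?K. form x x \<le> form g g"
    by (rule bexE)
  have "form x x * ip g g \<le> form g g" if g: "\<forall>s<r. ip (u s) g = 0" for g
  proof (cases "ip g g = 0")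
    case True
    then have "\<And>i. i \<in> I \<Longrightarrow> g i = 0" using ip_eq_0D by blast
    then show ?thesis using True by (simp add: form_def)
  next
    case False
    then have pos: "ip g g > 0" using ip_nonneg[of g] by simp
    from bspec[OF x(2) nrm_K[OF pos g]] show ?thesis
      using pos by (simp add: form_nrm_nrm[OF pos] field_simps)
  qed
  with x(1) show ?thesis by (intro exI[of _ x]) simp
qed

definition successive_minimizer :: "(nat \<Rightarrow> 'i \<Rightarrow> real) \<Rightarrow> nat \<Rightarrow> bool"
  where "successive_minimizer u r \<longleftrightarrow> ip (u r) (u r) = 1 \<and> (\<forall>s<r. ip (u s) (u r) = 0) \<and>
    (\<forall>g. (\<forall>s<r. ip (u s) g = 0) \<longrightarrow> form (u r) (u r) * ip g g \<le> form g g)"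

lemma successive_minimizers_exist: "\<exists>u. \<forall>r<card I. successive_minimizer u r"
proof -
  have "m \<le> card I \<Longrightarrow> \<exists>u. \<forall>r<m. successive_minimizer u r" for m
  proof (induction m)
    case (Suc m)
    then obtain u where u: "\<forall>r<m. successive_minimizer u r" by auto
    obtain x where x: "ip x x = 1" "\<forall>s<m. ip (u s) x = 0"
        "\<forall>g. (\<forall>s<m. ip (u s) g = 0) \<longrightarrow> form x x * ip g g \<le> form g g"
      using constrained_minimizer[of m u] Suc.prems by auto
    have "successive_minimizer (u(m := x)) r" if "r < Suc m" for r
    proof (cases "r = m")
      case True
      then show ?thesis using x by (simp add: successive_minimizer_def)
    next
      case False
      then show ?thesis using u that by (simp add: successive_minimizer_def)
    qed
    then show ?case by blast
  qed simp
  then show ?thesis by blast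
qed

end

section \<open>Eigenvalue equations and min-max bounds for the minimizers\<close>

locale minimizing_basis = symmetric_form +
  fixes u :: "nat \<Rightarrow> 'a \<Rightarrow> real"
  assumes minimizer: "\<And>r. r < card I \<Longrightarrow> successive_minimizer u r"
begin

text \<open>Indices start at 0, so \<open>ev (k - 1)\<close> is the \<open>k\<close>-th smallest
  eigenvalue.\<close>

abbreviation ev :: "nat \<Rightarrow> real" where "ev r \<equiv> form (u r) (u r)"

lemma orthonormal: "r < card I \<Longrightarrow> s < card I \<Longrightarrow> ip (u r) (u s) = (if r = s then 1 else 0)"
  using minimizer[of r] minimizer[of s] ip_commute[of "u r" "u s"]
  by (cases r s rule: linorder_cases) (auto simp: successive_minimizer_def)

lemma lower_bound: "r < card I \<Longrightarrow> (\<And>s. s < r \<Longrightarrow> ip (u s) g = 0) \<Longrightarrow> ev r * ip g g \<le> form g g"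
  using minimizer[of r] by (auto simp: successive_minimizer_def)

lemma ev_mono: "r \<le> s \<Longrightarrow> s < card I \<Longrightarrow> ev r \<le> ev s"
  using lower_bound[of r "u s"] by (auto simp: orthonormal)

text \<open>Moving from \<open>u r\<close> in the direction \<open>h\<close> keeps the constraints,
  so minimality makes a quadratic polynomial in \<open>t\<close> nonnegative; its linear coefficient
  must vanish.\<close>

lemma weak_eigen_orthogonal:
  assumes r: "r < card I" and h: "\<And>s. s < r \<Longrightarrow> ip (u s) h = 0"
  shows "form (u r) h = ev r * ip (u r) h"
proof -
  have "0 \<le> 2 * t * (form (u r) h - ev r * ip (u r) h) + t\<^sup>2 * (form h h - ev r * ip h h)" for t
  proof -
    define g where "g = (\<lambda>i. u r i + t * h i)"
    have "ip g g = ip (u r) (u r) + 2 * t * ip (u r) h + t\<^sup>2 * ip h h"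
      unfolding g_def ip_add_right ip_scale_right ip_add_left ip_scale_left
      by (simp add: ip_commute[of h "u r"] algebra_simps power2_eq_square)
    moreover have "form g g = ev r + 2 * t * form (u r) h + t\<^sup>2 * form h h"
      unfolding g_def form_add_right form_scale_right form_add_left form_scale_left
      by (simp add: form_commute[of h "u r"] algebra_simps power2_eq_square)
    moreover have "ev r * ip g g \<le> form g g"
      using r by (intro lower_bound) (auto simp: g_def ip_add_right ip_scale_right h orthonormal)
    ultimately show ?thesis using r by (simp add: orthonormal algebra_simps)
  qed
  from linear_coeff_zero[OF this] show ?thesis by simp
qed

text \<open>Subtracting from \<open>h\<close> its projection \<open>p\<close> onto the earlier
  minimizers leaves an admissible direction. The induction hypothesis and symmetry give
  \<open>form (u r) (u s) = 0\<close> for \<open>s < r\<close>, so \<open>p\<close> contributes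
  nothing.\<close>

lemma weak_eigen: "r < card I \<Longrightarrow> form (u r) h = ev r * ip (u r) h"
proof (induction r arbitrary: h rule: less_induct)
  case (less r)
  define p where "p = (\<lambda>i. \<Sum>s\<in>{..<r}. ip (u s) h * u s i)"
  define h' where "h' = (\<lambda>i. h i + (-1) * p i)"
  have "ip (u t) p = (if t < r then ip (u t) h else 0)" if "t \<le> r" for t
  proof -
    have "ip (u t) p = (\<Sum>s<r. if t = s then ip (u s) h else 0)"
      unfolding p_def ip_sum_right using that less.prems by (intro sum.cong) (auto simp: orthonormal)
    then show ?thesis by simp
  qed
  then have ip_h': "ip (u t) h' = (if t < r then 0 else ip (u t) h)" if "t \<le> r" for t
    using that unfolding h'_def ip_add_right ip_scale_right by simp
  have "form (u r) (u s) = 0" if "s < r" for s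
    using less.IH[OF that, of "u r"] form_commute[of "u r" "u s"] that less.prems by (simp add: orthonormal)
  then have "form (u r) p = 0"
    unfolding p_def by (subst form_sum_right) auto
  then have "form (u r) h = form (u r) h'"
    unfolding h'_def form_add_right form_scale_right by simp
  also have "\<dots> = ev r * ip (u r) h'"
    using less.prems ip_h' by (intro weak_eigen_orthogonal) auto
  finally show ?case using ip_h'[of r] by simp
qed

lemma eigen:
  assumes "r < card I" "i \<in> I"
  shows "(\<Sum>j\<in>I. a i j * u r j) = ev r * (mu i * u r i)"
proof -
  \<comment> \<open>Testing against a point mass at \<open>i\<close> turns the weak equation into
    its \<open>i\<close>-th coordinate.\<close>
  let ?d = "\<lambda>j. if j = i then 1 else (0::real)"
  have "form (u r) ?d = (\<Sum>j\<in>I. a j i * u r j)"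
    unfolding form_def using assms finite_I by (simp add: if_distrib[of "(*) _"] cong: if_cong)
  moreover have "ip (u r) ?d = mu i * u r i"
    unfolding ip_def using assms finite_I by (simp add: if_distrib[of "(*) _"] cong: if_cong)
  ultimately show ?thesis
    using weak_eigen[OF assms(1), of ?d] by (simp add: a_sym[of i])
qed

lemma ip_combination:
  assumes "k \<le> card I" 
  shows "ip (\<lambda>i. \<Sum>s<k. c s * u s i) (\<lambda>i. \<Sum>s<k. c s * u s i) = (\<Sum>s<k. (c s)\<^sup>2)"
    and "form (\<lambda>i. \<Sum>s<k. c s * u s i) (\<lambda>i. \<Sum>s<k. c s * u s i) = (\<Sum>s<k. ev s * (c s)\<^sup>2)"
proof -
  define g where "g = (\<lambda>i. \<Sum>s<k. c s * u s i)"
  have ug: "ip (u t) g = c t" if "t < k" for t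
  proof -
    have "ip (u t) g = (\<Sum>s<k. if t = s then c s else 0)"
      unfolding g_def ip_sum_right using that assms by (intro sum.cong) (auto simp: orthonormal)
    then show ?thesis using that by simp
  qed
  have "ip g g = (\<Sum>s<k. c s * ip g (u s))"
    by (subst (2) g_def) (rule ip_sum_right)
  also have "\<dots> = (\<Sum>s<k. (c s)\<^sup>2)"
    by (intro sum.cong) (simp_all add: ip_commute[of g "u _"] ug power2_eq_square)
  finally show "ip (\<lambda>i. \<Sum>s<k. c s * u s i) (\<lambda>i. \<Sum>s<k. c s * u s i) = (\<Sum>s<k. (c s)\<^sup>2)"
    by (simp only: g_def)
  have "form g g = (\<Sum>s<k. c s * form g (u s))"
    by (subst (2) g_def) (rule form_sum_right, simp)
  also have "\<dots> = (\<Sum>s<k. ev s * (c s)\<^sup>2)"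
  proof (intro sum.cong refl)
    fix s assume "s \<in> {..<k}"
    then have "form g (u s) = ev s * c s"
      using weak_eigen[of s g] form_commute[of g "u s"] ug[of s] assms by simp
    then show "c s * form g (u s) = ev s * (c s)\<^sup>2"
      by (simp add: power2_eq_square)
  qed
  finally show "form (\<lambda>i. \<Sum>s<k. c s * u s i) (\<lambda>i. \<Sum>s<k. c s * u s i) = (\<Sum>s<k. ev s * (c s)\<^sup>2)"
    by (simp only: g_def)
qed

lemma upper_bound:
  assumes "k < card I"
  defines "g \<equiv> \<lambda>c i. \<Sum>s<Suc k. c s * u s i"
  shows "form (g c) (g c) \<le> ev k * ip (g c) (g c)"
proof -
  have "form (g c) (g c) = (\<Sum>s<Suc k. ev s * (c s)\<^sup>2)"
    unfolding g_def using assms by (intro ip_combination) simp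
  also have "\<dots> \<le> (\<Sum>s<Suc k. ev k * (c s)\<^sup>2)"
    using assms(1) ev_mono by (intro sum_mono mult_right_mono) auto
  also have "\<dots> = ev k * ip (g c) (g c)"
    unfolding g_def using assms by (subst ip_combination) (simp_all only: sum_distrib_left Suc_le_eq)
  finally show ?thesis .
qed

end

section \<open>Eigenvalues of subgraphs and the variational eigenvalue\<close>

lemma symmetric_form_minimizing_basis_exists:
  assumes "symmetric_form I mu a"
  shows "\<exists>u. minimizing_basis I mu a u"
  using symmetric_form.successive_minimizers_exist[OF assms] assms
  by (auto simp: minimizing_basis_def minimizing_basis_axioms_def)

section \<open>Identification with the matrix eigenvalues\<close>

lemma proots_linear_factors: "proots (\<Prod>x\<leftarrow>xs. [:- x, 1:]) = mset (xs :: 'a::idom list)"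
proof (induction xs)
  case (Cons x xs)
  have "(\<Prod>x\<leftarrow>xs. [:- x, 1:]) \<noteq> 0"
    by (simp add: prod_list_zero_iff image_iff)
  then have "proots ([:- x, 1:] * (\<Prod>x\<leftarrow>xs. [:- x, 1:])) = {#x#} + mset xs"
    by (subst proots_mult) (simp_all add: Cons.IH)
  then show ?case by simp
qed simp

text \<open>\<open>P\<close> has the columns \<open>u r\<close>; by orthonormality its inverse
  \<open>Q\<close> is the transpose weighted by \<open>mu\<close>, so the matrix is similar to the
  diagonal matrix of the \<open>ev r\<close>. These are already sorted, hence list the roots of the
  characteristic polynomial with multiplicity.\<close>

lemma eigval_mu_adj_matrix:
  fixes V0 :: "nat set"
  assumes "minimizing_basis V0 mu (\<lambda>i j. if {i, j} \<in> E0 then s {i, j} * w {i, j} else 0) u"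
    and k: "1 \<le> k" "k \<le> card V0"
  shows "eigval (mu_adj_matrix V0 E0 s w mu) k = 
    symmetric_form.form V0 (\<lambda>i j. if {i, j} \<in> E0 then s {i, j} * w {i, j} else 0) (u (k - 1)) (u (k - 1))"
proof -
  let ?a = "\<lambda>i j. if {i, j} \<in> E0 then s {i, j} * w {i, j} else 0"
  interpret minimizing_basis V0 mu ?a u by fact
  define v where "v = card V0"
  define vs where "vs = sorted_list_of_set V0"
  define M where "M = mu_adj_matrix V0 E0 s w mu"
  define P where "P = mat v v (\<lambda>(i, r). u r (vs ! i))"
  define Q where "Q = mat v v (\<lambda>(r, i). mu (vs ! i) * u r (vs ! i))"
  define D where "D = mat v v (\<lambda>(r, t). if r = t then ev r else 0)"
  have vs: "set vs = V0" "length vs = v" "distinct vs"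
    using finite_I by (simp_all add: vs_def v_def)
  have vs_in: "vs ! i \<in> V0" if "i < v" for i
    using that vs nth_mem by blast
  have sum_vs: "(\<Sum>i<v. f (vs ! i)) = (\<Sum>x\<in>V0. f x)" for f :: "nat \<Rightarrow> real"
  proof -
    have "bij_betw ((!) vs) {..<v} V0"
      using bij_betw_nth[OF vs(3)] vs by (simp add: lessThan_def)
    then show ?thesis by (rule sum.reindex_bij_betw)
  qed
  have M: "M = mat v v (\<lambda>(i, j). 1 / mu (vs ! i) * ?a (vs ! i) (vs ! j))"
    unfolding M_def mu_adj_matrix_def Let_def v_def vs_def ..
  have carrier: "M \<in> carrier_mat v v" "P \<in> carrier_mat v v" "Q \<in> carrier_mat v v" "D \<in> carrier_mat v v"
    by (simp_all add: M P_def Q_def D_def)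
  have QP: "Q * P = 1\<^sub>m v"
  proof (rule eq_matI)
    fix r t assume "r < dim_row (1\<^sub>m v :: real mat)" "t < dim_col (1\<^sub>m v :: real mat)"
    then have rt: "r < v" "t < v" by simp_all
    have "(Q * P) $$ (r, t) = (\<Sum>i<v. mu (vs ! i) * u r (vs ! i) * u t (vs ! i))"
      using rt by (simp add: Q_def P_def scalar_prod_def lessThan_atLeast0)
    also have "\<dots> = ip (u r) (u t)"
      unfolding ip_def by (rule sum_vs)
    finally show "(Q * P) $$ (r, t) = 1\<^sub>m v $$ (r, t)"
      using rt by (simp add: orthonormal v_def)
  qed (auto simp: P_def Q_def)
  then have PQ: "P * Q = 1\<^sub>m v"
    using mat_mult_left_right_inverse carrier by blast
  have MP: "M * P = P * D"
  proof (rule eq_matI)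
    fix i r assume "i < dim_row (P * D)" "r < dim_col (P * D)"
    then have ir: "i < v" "r < v" by (simp_all add: P_def D_def)
    have "(M * P) $$ (i, r) = (\<Sum>j<v. 1 / mu (vs ! i) * (?a (vs ! i) (vs ! j) * u r (vs ! j)))"
      using ir by (simp add: M P_def scalar_prod_def lessThan_atLeast0 mult.assoc)
    also have "\<dots> = 1 / mu (vs ! i) * (\<Sum>j\<in>V0. ?a (vs ! i) j * u r j)"
      unfolding sum_distrib_left[symmetric] by (subst sum_vs) (rule refl)
    also have "\<dots> = u r (vs ! i) * ev r"
      using ir mu_pos[OF vs_in[OF ir(1)]] by (subst eigen) (auto simp: v_def vs_in)
    also have "\<dots> = (\<Sum>t<v. if t = r then u r (vs ! i) * ev r else 0)"
      using ir by simp
    also have "\<dots> = (P * D) $$ (i, r)"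
      using ir unfolding P_def D_def
      by (simp add: scalar_prod_def lessThan_atLeast0 if_distrib[of "(*) _"] cong: if_cong)
    finally show "(M * P) $$ (i, r) = (P * D) $$ (i, r)" .
  qed (auto simp: M P_def D_def)
  have "M = M * (P * Q)"
    using carrier by (simp add: PQ)
  also have "\<dots> = P * D * Q"
    using carrier by (simp add: MP flip: assoc_mult_mat[of M v v P v Q v])
  finally have "similar_mat M D"
    unfolding similar_mat_def similar_mat_wit_def Let_def using carrier PQ QP
    by (intro exI[of _ P] exI[of _ Q]) auto
  then have "char_poly M = char_poly D"
    by (rule char_poly_similar)
  also have "\<dots> = (\<Prod>x\<leftarrow>diag_mat D. [:- x, 1:])"
    by (rule char_poly_upper_triangular[OF carrier(4)]) (auto simp: D_def)
  also have "diag_mat D = map ev [0..<v]"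
    by (auto simp: diag_mat_def D_def)
  finally have "proots (char_poly M) = mset (map ev [0..<v])"
    by (simp only: proots_linear_factors)
  moreover have "sorted (map ev [0..<v])"
    by (auto simp: sorted_iff_nth_mono v_def intro: ev_mono)
  ultimately have "sorted_list_of_multiset (proots (char_poly M)) = map ev [0..<v]"
    by (simp add: sorted_list_of_multiset_mset sorted_sort_id del: mset_map)
  then show ?thesis
    using k nth_upt[of 0 "k - 1" v] by (simp add: eigval_def M_def[symmetric] v_def)
qed

section \<open>Interlacing for subgraphs\<close>

context
  fixes n :: nat and E :: "nat set set" and sg w :: "nat set \<Rightarrow> real" and mu :: "nat \<Rightarrow> real"
  assumes graph: "signed_graph n E sg w mu"
begin

lemma mu_positive: "i \<in> {1..n} \<Longrightarrow> mu i > 0"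
  using graph by (auto simp: signed_graph_def)

lemma subgraph_minimizing_basis:
  assumes "is_subgraph n E V0 E0"
  shows "\<exists>u. minimizing_basis V0 mu (\<lambda>i j. if {i, j} \<in> E0 then s {i, j} * w {i, j} else 0) u"
proof (rule symmetric_form_minimizing_basis_exists, unfold_locales)
  show "finite V0"
    using assms finite_subset by (auto simp: is_subgraph_def)
  show "mu i > 0" if "i \<in> V0" for i
    using assms that mu_positive by (auto simp: is_subgraph_def)
qed (simp add: insert_commute)

text \<open>
  Courant--Fischer: combinations of the first \<open>k\<close> eigenvectors on all vertices, subject to vanishing
  outside \<open>V0\<close> and to orthogonality to the first eigenvectors on \<open>V0\<close>, satisfy only \<open>k - 1\<close> equations.
\<close>

lemma eigval_subgraph_le_spanning:
  assumes sub: "is_subgraph n E V0 E0" and k: "k \<le> n" "n < card V0 + k"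
  shows "eigval (mu_adj_matrix V0 E0 s w mu) (card V0 + k - n) \<le> eigval (mu_adj_matrix {1..n} E0 s w mu) k"
proof -
  let ?a = "\<lambda>i j. if {i, j} \<in> E0 then s {i, j} * w {i, j} else 0"
  let ?V = "{1..n}"
  have V0: "V0 \<subseteq> ?V" "finite V0" and E0: "\<And>e. e \<in> E0 \<Longrightarrow> e \<subseteq> V0"
    using sub finite_subset by (auto simp: is_subgraph_def)
  have sub': "is_subgraph n E ?V E0"
    using sub V0 by (auto simp: is_subgraph_def)
  obtain u where "minimizing_basis ?V mu ?a u" using subgraph_minimizing_basis[OF sub'] by blast
  then interpret V: minimizing_basis ?V mu ?a u .
  obtain u0 where "minimizing_basis V0 mu ?a u0" using subgraph_minimizing_basis[OF sub] by blast
  then interpret V0: minimizing_basis V0 mu ?a u0 .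
  \<comment> \<open>\<open>d\<close> counts the missing vertices and \<open>m\<close> is the
    zero-based index of the eigenvalue on \<open>V0\<close>; together they give \<open>k - 1\<close>
    equations for \<open>k\<close> coefficients.\<close>
  define d where "d = n - card V0"
  define m where "m = card V0 + k - n - 1"
  have cV0: "card V0 \<le> n" using card_mono[OF _ V0(1)] by simp
  have m: "m < card V0" "d + m < k" "d + m = k - 1" using k cV0 by (auto simp: d_def m_def)
  have "card (?V - V0) = d"
    using card_Diff_subset[OF V0(2,1)] by (simp add: d_def)
  then obtain e where e: "bij_betw e {0..<d} (?V - V0)"
    using ex_bij_betw_nat_finite[of "?V - V0"] by auto
  \<comment> \<open>Rows below \<open>d\<close> ask for zeros at the missing vertices, the next
    \<open>m\<close> for orthogonality to the first \<open>m\<close> minimizers on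
    \<open>V0\<close>.\<close>
  define b where "b t r = (if t < d then u r (e t) else V0.ip (u0 (t - d)) (u r))" for t r
  obtain c where c: "\<exists>r\<in>{..<k}. c r \<noteq> 0" "\<forall>t<d + m. (\<Sum>r<k. b t r * c r) = 0"
    using homogeneous_system_solution[of "{..<k}" "d + m" b] m(2) by auto
  define g where "g = (\<lambda>i. \<Sum>r<Suc (k - 1). c r * u r i)"
  have k1: "Suc (k - 1) = k" "k - 1 < card ?V" using m(2) k by auto
  have outside: "g i = 0" if i: "i \<in> ?V - V0" for i
  proof -
    obtain t where t: "t < d" "e t = i"
      using e i by (metis atLeastLessThan_iff bij_betw_imp_surj_on imageE)
    then show ?thesis using c(2)[rule_format, of t] unfolding g_def k1 by (simp add: b_def mult.commute)
  qed
  have orth: "V0.ip (u0 t) g = 0" if "t < m" for t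
    using c(2)[rule_format, of "d + t"] that
    unfolding g_def k1 V0.ip_sum_right by (simp add: b_def mult.commute)
  have ip_eq: "V.ip g g = V0.ip g g"
    unfolding V.ip_def V0.ip_def using V0 outside by (intro sum.mono_neutral_right) auto
  have "(\<Sum>j\<in>?V. ?a i j * g i * g j) = (\<Sum>j\<in>V0. ?a i j * g i * g j)" for i
    using V0 outside by (intro sum.mono_neutral_right) auto
  then have "V.form g g = (\<Sum>i\<in>?V. \<Sum>j\<in>V0. ?a i j * g i * g j)"
    unfolding V.form_def by simp
  also have "\<dots> = V0.form g g"
    unfolding V0.form_def using V0 outside by (intro sum.mono_neutral_right) auto
  finally have form_eq: "V.form g g = V0.form g g" .
  obtain r where "r < k" "c r \<noteq> 0" using c(1) by auto
  then have "0 < (\<Sum>r<k. (c r)\<^sup>2)"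
    by (intro sum_pos2[of _ r]) auto
  also have "\<dots> = V.ip g g"
    unfolding g_def k1 using k by (subst V.ip_combination) auto
  finally have pos: "V.ip g g > 0" .
  have "V0.ev m * V.ip g g \<le> V.form g g"
    unfolding ip_eq form_eq by (rule V0.lower_bound[OF m(1) orth])
  also have "\<dots> \<le> V.ev (k - 1) * V.ip g g"
    unfolding g_def by (rule V.upper_bound[OF k1(2)])
  finally have "V0.ev m \<le> V.ev (k - 1)" using pos by simp
  moreover have "eigval (mu_adj_matrix V0 E0 s w mu) (card V0 + k - n) = V0.ev m"
    unfolding m_def using k by (intro eigval_mu_adj_matrix V0.minimizing_basis_axioms) auto
  moreover have "eigval (mu_adj_matrix ?V E0 s w mu) k = V.ev (k - 1)"
    using k m(2) by (intro eigval_mu_adj_matrix V.minimizing_basis_axioms) auto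
  ultimately show ?thesis by simp
qed

end

section \<open>Signed powers and the edge inequality\<close>

text \<open>
  The odd substitution \<open>x \<mapsto> sgn x * |x| powr (p / 2)\<close> carries the \<open>p\<close>-sphere to the unit sphere of a
  weighted inner product.
\<close>

definition signed_power :: "real \<Rightarrow> real \<Rightarrow> real"
  where "signed_power q x = sgn x * \<bar>x\<bar> powr q"

lemma signed_power_minus: "signed_power q (- x) = - signed_power q x"
  by (simp add: signed_power_def sgn_minus)

lemma signed_power_half_square: "signed_power (p / 2) x * signed_power (p / 2) x = \<bar>x\<bar> powr p"
proof -
  have "\<bar>x\<bar> powr (p/2) * \<bar>x\<bar> powr (p/2) = \<bar>x\<bar> powr p"
    by (simp flip: powr_add)
  then show ?thesis
    by (cases "x = 0") (auto simp: signed_power_def sgn_if)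
qed

lemma continuous_signed_power:
  assumes "q > 0"
  shows "continuous_on UNIV (signed_power q)"
proof -
  \<comment> \<open>Separating positive and negative parts removes the jump of \<open>sgn\<close> at
    0.\<close>
  have eq: "signed_power q x = max x 0 powr q - max (- x) 0 powr q" for x
    by (auto simp: signed_power_def sgn_if max_def)
  show ?thesis
    unfolding eq[abs_def] using assms
    by (intro continuous_on_diff continuous_on_powr' continuous_on_max continuous_on_minus
        continuous_on_id continuous_on_const) auto
qed

text \<open>If \<open>- \<sigma> * x * y\<close> is not positive, neither is the left side.
  Otherwise the absolute value on the right is \<open>\<bar>x\<bar> + \<bar>y\<bar>\<close>, and the
  claim is AM-GM raised to the power \<open>p / 2\<close>.\<close>

lemma powr_edge_lower_bound:
  fixes x y \<sigma> p :: real
  assumes p: "p \<ge> 1" and \<sigma>: "\<sigma> = 1 \<or> \<sigma> = -1"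
  shows "2 powr p * (- \<sigma> * signed_power (p / 2) x * signed_power (p / 2) y) \<le> \<bar>x - \<sigma> * y\<bar> powr p"
proof (cases "- \<sigma> * sgn x * sgn y > 0")
  case False
  have "- \<sigma> * signed_power (p / 2) x * signed_power (p / 2) y = 
      (- \<sigma> * sgn x * sgn y) * (\<bar>x\<bar> powr (p / 2) * \<bar>y\<bar> powr (p / 2))"
    by (simp add: signed_power_def)
  also have "\<dots> \<le> 0" using False by (metis mult_nonneg_nonneg mult_nonpos_nonneg not_less powr_ge_zero)
  finally have "2 powr p * (- \<sigma> * signed_power (p / 2) x * signed_power (p / 2) y) \<le> 0"
    by (rule mult_nonneg_nonpos[OF powr_ge_zero])
  then show ?thesis using powr_ge_zero[of "\<bar>x - \<sigma> * y\<bar>" p] by linarith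
next
  case True
  then have s: "- \<sigma> * sgn x * sgn y = 1" "\<bar>x - \<sigma> * y\<bar> = \<bar>x\<bar> + \<bar>y\<bar>"
    using \<sigma> by (auto simp: sgn_if split: if_splits)
  have "- \<sigma> * signed_power (p / 2) x * signed_power (p / 2) y = 
      (- \<sigma> * sgn x * sgn y) * (\<bar>x\<bar> powr (p / 2) * \<bar>y\<bar> powr (p / 2))"
    by (simp add: signed_power_def)
  then have "2 powr p * (- \<sigma> * signed_power (p / 2) x * signed_power (p / 2) y) 
      = (2\<^sup>2 * (\<bar>x\<bar> * \<bar>y\<bar>)) powr (p / 2)"
    unfolding s by (simp add: powr_mult powr_powr flip: powr_numeral)
  also have "\<dots> \<le> ((\<bar>x\<bar> + \<bar>y\<bar>)\<^sup>2) powr (p / 2)"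
  proof (rule powr_mono2)
    have "0 \<le> (\<bar>x\<bar> - \<bar>y\<bar>)\<^sup>2" by simp
    then show "2\<^sup>2 * (\<bar>x\<bar> * \<bar>y\<bar>) \<le> (\<bar>x\<bar> + \<bar>y\<bar>)\<^sup>2"
      by (simp add: power2_eq_square algebra_simps)
  qed (use p in auto)
  also have "\<dots> = (\<bar>x\<bar> + \<bar>y\<bar>) powr p"
    by (simp add: powr_powr flip: powr_numeral)
  finally show ?thesis unfolding s .
qed

text \<open>The form runs over ordered pairs, the energy over edges; this factor 2 turns
  \<open>2 powr p\<close> into \<open>2 powr (p - 1)\<close>.\<close>

lemma sum_symmetric_offdiagonal:
  fixes h :: "nat \<Rightarrow> nat \<Rightarrow> real"
  assumes "\<And>i j. h i j = h j i" "\<And>i. h i i = 0"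
  shows "(\<Sum>i\<in>A. \<Sum>j\<in>A. h i j) = 2 * (\<Sum>i\<in>A. \<Sum>j\<in>A. if i < j then h i j else 0)"
proof -
  have "h i j = (if i < j then h i j else 0) + (if j < i then h j i else 0)" for i j
    using assms(1)[of i j] assms(2)[of i] by (cases i j rule: linorder_cases) auto
  then have "(\<Sum>i\<in>A. \<Sum>j\<in>A. h i j) = 
      (\<Sum>i\<in>A. \<Sum>j\<in>A. if i < j then h i j else 0) + (\<Sum>i\<in>A. \<Sum>j\<in>A. if j < i then h j i else 0)"
    by (simp only: sum.distrib[symmetric])
  also have "(\<Sum>i\<in>A. \<Sum>j\<in>A. if j < i then h j i else 0) = (\<Sum>i\<in>A. \<Sum>j\<in>A. if i < j then h i j else 0)"
    by (rule sum.swap)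
  finally show ?thesis by simp
qed

section \<open>Lower bound for the variational eigenvalues\<close>

context
  fixes n :: nat and E :: "nat set set" and sg w :: "nat set \<Rightarrow> real" and mu kappa :: "nat \<Rightarrow> real" and p :: real
  assumes graph: "signed_graph n E sg w mu" and p: "p \<ge> 1"
begin

lemma edge_sign: "e \<in> E \<Longrightarrow> sg e = 1 \<or> sg e = -1" and edge_weight: "e \<in> E \<Longrightarrow> w e > 0"
  and no_loops: "{i} \<notin> E"
  using graph by (auto simp: signed_graph_def doubleton_eq_iff)

lemma sphere_p_powr_le:
  assumes "f \<in> sphere_p n mu p" "i \<in> {1..n}"
  shows "\<bar>f i\<bar> powr p \<le> 1 / mu i"
proof -
  have "mu i * \<bar>f i\<bar> powr p \<le> (\<Sum>i=1..n. mu i * \<bar>f i\<bar> powr p)"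
    using assms mu_positive[OF graph] by (intro member_le_sum) (auto simp: less_imp_le)
  then show ?thesis
    using assms mu_positive[OF graph assms(2)] by (simp add: sphere_p_def field_simps)
qed

text \<open>Boundedness makes the suprema in \<open>lambda_p\<close> genuine upper bounds.\<close>

lemma bdd_above_rayleigh_p: "bdd_above (rayleigh_p n E sg w mu kappa p ` sphere_p n mu p)"
proof (rule bdd_aboveI2)
  fix f assume f: "f \<in> sphere_p n mu p"
  have "(\<Sum>i=1..n. \<Sum>j=1..n. if i < j \<and> {i, j} \<in> E then w {i, j} * \<bar>f i - sg {i, j} * f j\<bar> powr p else 0)
      \<le> (\<Sum>i=1..n. \<Sum>j=1..n. if i < j \<and> {i, j} \<in> E then w {i, j} * (2 powr p * (1 / mu i + 1 / mu j)) else 0)"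
  proof (intro sum_mono)
    fix i j assume ij: "i \<in> {1..n}" "j \<in> {1..n}"
    show "(if i < j \<and> {i, j} \<in> E then w {i, j} * \<bar>f i - sg {i, j} * f j\<bar> powr p else 0)
      \<le> (if i < j \<and> {i, j} \<in> E then w {i, j} * (2 powr p * (1 / mu i + 1 / mu j)) else 0)"
    proof (cases "i < j \<and> {i, j} \<in> E")
      case True
      have "\<bar>f i - sg {i, j} * f j\<bar> \<le> 2 * max \<bar>f i\<bar> \<bar>f j\<bar>"
        using edge_sign[of "{i, j}"] True by auto
      then have "\<bar>f i - sg {i, j} * f j\<bar> powr p \<le> (2 * max \<bar>f i\<bar> \<bar>f j\<bar>) powr p"
        using p by (intro powr_mono2) auto
      also have "\<dots> = 2 powr p * max \<bar>f i\<bar> \<bar>f j\<bar> powr p"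
        by (simp add: powr_mult)
      also have "\<dots> \<le> 2 powr p * (\<bar>f i\<bar> powr p + \<bar>f j\<bar> powr p)"
        by (intro mult_left_mono) (auto simp: max_def)
      also have "\<dots> \<le> 2 powr p * (1 / mu i + 1 / mu j)"
        using sphere_p_powr_le[OF f] ij by (intro mult_left_mono add_mono) auto
      finally show ?thesis
        using True edge_weight[of "{i, j}"] by auto
    qed auto
  qed
  moreover have "(\<Sum>i=1..n. kappa i * \<bar>f i\<bar> powr p) \<le> (\<Sum>i=1..n. \<bar>kappa i\<bar> * (1 / mu i))"
    using sphere_p_powr_le[OF f] by (intro sum_mono mult_mono) auto
  ultimately show "rayleigh_p n E sg w mu kappa p f \<le> 
      (\<Sum>i=1..n. \<Sum>j=1..n. if i < j \<and> {i, j} \<in> E then w {i, j} * (2 powr p * (1 / mu i + 1 / mu j)) else 0)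
      + (\<Sum>i=1..n. \<bar>kappa i\<bar> * (1 / mu i))"
    using f by (simp add: rayleigh_p_def sphere_p_def)
qed

lemma rayleigh_p_lower_bound:
  fixes C :: real
  assumes E0: "E0 \<subseteq> E" and f: "f \<in> sphere_p n mu p"
    and C: "\<And>i. i \<in> {1..n} \<Longrightarrow> \<bar>kappa i / mu i\<bar> \<le> C"
  defines "g \<equiv> \<lambda>i. signed_power (p / 2) (f i)"
  shows "2 powr (p - 1) * (\<Sum>i=1..n. \<Sum>j=1..n. (if {i, j} \<in> E0 then - sg {i, j} * w {i, j} else 0) * g i * g j) - C
    \<le> rayleigh_p n E sg w mu kappa p f"
proof -
  let ?a = "\<lambda>i j. if {i, j} \<in> E0 then - sg {i, j} * w {i, j} else 0"
  have "{i} \<notin> E0" for i using no_loops E0 by blast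
  then have "(\<Sum>i=1..n. \<Sum>j=1..n. ?a i j * g i * g j) 
      = 2 * (\<Sum>i=1..n. \<Sum>j=1..n. if i < j then ?a i j * g i * g j else 0)"
    by (intro sum_symmetric_offdiagonal) (auto simp: insert_commute)
  then have "2 powr (p - 1) * (\<Sum>i=1..n. \<Sum>j=1..n. ?a i j * g i * g j)
      = 2 powr p * (\<Sum>i=1..n. \<Sum>j=1..n. if i < j then ?a i j * g i * g j else 0)"
    by (simp add: powr_diff)
  also have "\<dots> = (\<Sum>i=1..n. \<Sum>j=1..n. 2 powr p * (if i < j then ?a i j * g i * g j else 0))"
    by (simp only: sum_distrib_left)
  also have "\<dots> \<le> (\<Sum>i=1..n. \<Sum>j=1..n. if i < j \<and> {i, j} \<in> E 
      then w {i, j} * \<bar>f i - sg {i, j} * f j\<bar> powr p else 0)"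
  proof (intro sum_mono)
    fix i j :: nat
    show "2 powr p * (if i < j then ?a i j * g i * g j else 0)
      \<le> (if i < j \<and> {i, j} \<in> E then w {i, j} * \<bar>f i - sg {i, j} * f j\<bar> powr p else 0)"
    proof (cases "i < j \<and> {i, j} \<in> E0")
      case True
      then have e: "{i, j} \<in> E" using E0 by blast
      have "2 powr p * (?a i j * g i * g j) = w {i, j} * (2 powr p * (- sg {i, j} * g i * g j))"
        using True by simp
      also have "\<dots> \<le> w {i, j} * \<bar>f i - sg {i, j} * f j\<bar> powr p"
        using edge_weight[OF e] powr_edge_lower_bound[OF p edge_sign[OF e], of "f i" "f j"]
        unfolding g_def by (intro mult_left_mono) auto
      finally show ?thesis using True e by simp
    next
      case False
      \<comment> \<open>Edges outside \<open>E0\<close> have nonnegative energy and may be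
        dropped.\<close>
      then have "2 powr p * (if i < j then ?a i j * g i * g j else 0) = 0" by auto
      then show ?thesis using edge_weight[of "{i, j}"] by (auto simp: less_imp_le)
    qed
  qed
  finally have edges: "2 powr (p - 1) * (\<Sum>i=1..n. \<Sum>j=1..n. ?a i j * g i * g j) \<le> \<dots>" .
  \<comment> \<open>The normalization of \<open>f\<close> spreads the constant over the
    vertices.\<close>
  have "- C = - C * (\<Sum>i=1..n. mu i * \<bar>f i\<bar> powr p)"
    using f by (simp add: sphere_p_def)
  also have "\<dots> = (\<Sum>i=1..n. - C * (mu i * \<bar>f i\<bar> powr p))"
    by (rule sum_distrib_left)
  also have "\<dots> \<le> (\<Sum>i=1..n. kappa i * \<bar>f i\<bar> powr p)"
  proof (rule sum_mono)
    fix i assume i: "i \<in> {1..n}"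
    have "- C * mu i \<le> kappa i"
      using C[OF i] mu_positive[OF graph i] by (auto simp: abs_le_iff field_simps)
    then have "- C * mu i * \<bar>f i\<bar> powr p \<le> kappa i * \<bar>f i\<bar> powr p"
      by (intro mult_right_mono) auto
    then show "- C * (mu i * \<bar>f i\<bar> powr p) \<le> kappa i * \<bar>f i\<bar> powr p"
      by (simp add: mult.assoc)
  qed
  finally show ?thesis
    using edges f by (simp add: rayleigh_p_def sphere_p_def)
qed

lemma lambda_p_lower_bound:
  fixes C :: real
  assumes k: "1 \<le> k" "k \<le> n" and sub: "is_subgraph n E {1..n} E0"
    and C: "\<And>i. i \<in> {1..n} \<Longrightarrow> \<bar>kappa i / mu i\<bar> \<le> C"
  shows "2 powr (p - 1) * eigval (mu_adj_matrix {1..n} E0 (\<lambda>e. - sg e) w mu) k - C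
    \<le> lambda_p n E sg w mu kappa p k"
  unfolding lambda_p_def
proof (rule cINF_greatest)
  show "Fk n mu p k \<noteq> {}"
    using sphere_p_in_Fk[of n mu p k] mu_positive[OF graph] p k by blast
  fix B assume B: "B \<in> Fk n mu p k"
  then have BS: "B \<subseteq> sphere_p n mu p" and genus: "k \<le> kgenus B"
    by (auto simp: Fk_def)
  let ?a = "\<lambda>i j. if {i, j} \<in> E0 then - sg {i, j} * w {i, j} else 0"
  obtain u where "minimizing_basis {1..n} mu ?a u"
    using subgraph_minimizing_basis[OF graph sub, of "\<lambda>e. - sg e"] by blast
  then interpret minimizing_basis "{1..n}" mu ?a u .
  define g where "g f = (\<lambda>i. signed_power (p / 2) (f i))" for f :: "nat \<Rightarrow> real"
  \<comment> \<open>Signed powers are odd, so these are \<open>k - 1\<close> odd conditions on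
    \<open>f\<close>; genus at least \<open>k\<close> forces a common zero.\<close>
  have "\<exists>f\<in>B. \<forall>s<k - 1. ip (u s) (g f) = 0"
  proof (rule odd_map_vanishes[OF genus])
    show "k - 1 < k" using k by simp
    show "continuous_on B (\<lambda>f. ip (u s) (g f))" for s
      unfolding ip_def g_def
      by (intro continuous_on_sum continuous_on_mult continuous_on_const
          continuous_on_compose2[OF continuous_signed_power] 
          continuous_on_subset[OF continuous_on_product_coordinates]) (use p in auto)
    show "ip (u s) (g (\<lambda>i. - f i)) = - ip (u s) (g f)" for f s
      unfolding ip_def g_def signed_power_minus by (simp add: sum_negf)
  qed
  then obtain f where f: "f \<in> B" "\<And>s. s < k - 1 \<Longrightarrow> ip (u s) (g f) = 0" by blast
  then have fS: "f \<in> sphere_p n mu p" using BS by blast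
  have "ip (g f) (g f) = (\<Sum>i=1..n. mu i * \<bar>f i\<bar> powr p)"
    unfolding ip_def g_def mult.assoc signed_power_half_square ..
  then have "ip (g f) (g f) = 1" using fS by (simp add: sphere_p_def)
  then have "ev (k - 1) \<le> form (g f) (g f)"
    using lower_bound[of "k - 1" "g f"] f(2) k by simp
  moreover have "eigval (mu_adj_matrix {1..n} E0 (\<lambda>e. - sg e) w mu) k = ev (k - 1)"
    using k minimizing_basis_axioms by (intro eigval_mu_adj_matrix) auto
  ultimately have "2 powr (p - 1) * eigval (mu_adj_matrix {1..n} E0 (\<lambda>e. - sg e) w mu) k - C
      \<le> 2 powr (p - 1) * form (g f) (g f) - C"
    by simp
  also have "\<dots> \<le> rayleigh_p n E sg w mu kappa p f"
    unfolding form_def g_def using sub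
    by (intro rayleigh_p_lower_bound[OF _ fS C]) (auto simp: is_subgraph_def)
  also have "\<dots> \<le> (SUP f\<in>B. rayleigh_p n E sg w mu kappa p f)"
    using f(1) BS by (intro cSUP_upper bdd_above_mono[OF bdd_above_rayleigh_p]) auto
  finally show "2 powr (p - 1) * eigval (mu_adj_matrix {1..n} E0 (\<lambda>e. - sg e) w mu) k - C
    \<le> (SUP f\<in>B. rayleigh_p n E sg w mu kappa p f)" .
qed

end

section \<open>The bound and the equality of the two maxima\<close>

theorem theorem5p4:
  fixes n k :: nat and E :: "nat set set" and sg w :: "nat set \<Rightarrow> real"
    and mu kappa :: "nat \<Rightarrow> real" and p :: real
  assumes "signed_graph n E sg w mu"
    and "p \<ge> 1" and "1 \<le> k" and "k \<le> n"
  shows "let C = Max ((\<lambda>i. \<bar>kappa i / mu i\<bar>) ` {1..n});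
             M1 = Max {eigval (mu_adj_matrix V0 E0 (\<lambda>e. - sg e) w mu) (card V0 + k - n)
                        | V0 E0. is_subgraph n E V0 E0 \<and> card V0 \<ge> n - k + 1};
             M2 = Max {eigval (mu_adj_matrix V0 E0 (\<lambda>e. - sg e) w mu) k
                        | V0 E0. is_subgraph n E V0 E0 \<and> card V0 = n}
         in lambda_p n E sg w mu kappa p k \<ge> 2 powr (p - 1) * M1 - C
            \<and> 2 powr (p - 1) * M1 - C = 2 powr (p - 1) * M2 - C"
proof -
  define C where "C = Max ((\<lambda>i. \<bar>kappa i / mu i\<bar>) ` {1..n})"
  define e where "e = (\<lambda>V0 E0. eigval (mu_adj_matrix V0 E0 (\<lambda>e. - sg e) w mu))"
  define S1 where "S1 = {e V0 E0 (card V0 + k - n) | V0 E0. is_subgraph n E V0 E0 \<and> card V0 \<ge> n - k + 1}"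
  define S2 where "S2 = {e V0 E0 k | V0 E0. is_subgraph n E V0 E0 \<and> card V0 = n}"
  have full: "V0 = {1..n}" if "is_subgraph n E V0 E0" "card V0 = n" for V0 E0
    using that card_subset_eq[of "{1..n}" V0] by (auto simp: is_subgraph_def)
  have "E \<subseteq> Pow {1..n}"
    using assms(1) by (auto simp: signed_graph_def)
  then have "finite E" by (rule finite_subset) simp
  have "S1 \<subseteq> (\<lambda>(V0, E0). e V0 E0 (card V0 + k - n)) ` (Pow {1..n} \<times> Pow E)"
    unfolding S1_def is_subgraph_def by force
  then have fin1: "finite S1"
    by (rule finite_subset) (simp add: \<open>finite E\<close>)
  have "S2 \<subseteq> S1"
  proof
    fix x assume "x \<in> S2"
    then obtain V0 E0 where "x = e V0 E0 k" "is_subgraph n E V0 E0" "card V0 = n"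
      unfolding S2_def by blast
    \<comment> \<open>For \<open>card V0 = n\<close> the index \<open>card V0 + k - n\<close> is
      \<open>k\<close>.\<close>
    then show "x \<in> S1" using assms(3,4) unfolding S1_def by force
  qed
  have "is_subgraph n E {1..n} {}" by (simp add: is_subgraph_def)
  then have "S2 \<noteq> {}" unfolding S2_def by force
  then have fin2: "finite S2" and ne1: "S1 \<noteq> {}"
    using fin1 \<open>S2 \<subseteq> S1\<close> finite_subset by blast+
  \<comment> \<open>Adding the missing vertices as isolated ones gives a spanning subgraph whose
    \<open>k\<close>-th eigenvalue is at least \<open>x\<close>.\<close>
  have "x \<le> Max S2" if S1: "x \<in> S1" for x
  proof -
    obtain V0 E0 where x: "x = e V0 E0 (card V0 + k - n)" "is_subgraph n E V0 E0" "card V0 \<ge> n - k + 1"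
      using S1 unfolding S1_def by blast
    then have "x \<le> e {1..n} E0 k"
      unfolding e_def x(1) using assms(1,4) by (intro eigval_subgraph_le_spanning) auto
    moreover have "is_subgraph n E {1..n} E0"
      using x(2) by (auto simp: is_subgraph_def)
    then have "e {1..n} E0 k \<in> S2"
      unfolding S2_def by force
    ultimately show ?thesis using Max_ge[OF fin2] by fastforce
  qed
  then have eq: "Max S1 = Max S2"
    using Max_mono[OF \<open>S2 \<subseteq> S1\<close> \<open>S2 \<noteq> {}\<close> fin1] ne1 fin1 by (intro antisym) auto
  obtain V0 E0 where V0: "Max S2 = e V0 E0 k" "is_subgraph n E V0 E0" "card V0 = n"
    using Max_in[OF fin2 \<open>S2 \<noteq> {}\<close>] unfolding S2_def by blast
  have "is_subgraph n E {1..n} E0"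
    using V0(2) full[OF V0(2,3)] by simp
  then have "2 powr (p - 1) * e {1..n} E0 k - C \<le> lambda_p n E sg w mu kappa p k"
    unfolding e_def by (rule lambda_p_lower_bound[OF assms]) (simp only: C_def, rule Max_ge, auto)
  then have "2 powr (p - 1) * Max S2 - C \<le> lambda_p n E sg w mu kappa p k"
    using V0(1) full[OF V0(2,3)] by simp
  with eq show ?thesis
    unfolding Let_def S1_def[symmetric] S2_def[symmetric] C_def[symmetric] e_def
    by (simp add: C_def S1_def S2_def e_def)
qed

end
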